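(* Let $n\ge 2$. For a polynomial $f\in\mathbb{R}[x_1,\dots,x_n]$ let $f_{\min}=\min_{x\in\mathbb{S}^{n-1}}f(x)$ and, for $r\in\mathbb{N}$, let $$\overline f^{(r)}=\inf_{h\in\Sigma[x]_r}\Big\{\int_{\mathbb{S}^{n-1}}h(x)f(x)\,d\sigma(x)\;:\;\int_{\mathbb{S}^{n-1}}h(x)\,d\sigma(x)=1\Big\}.$$ Then: (i) For any polynomial $f$ we have $\overline f^{(r)}-f_{\min}=O\left(\frac{1}{r^2}\right)$, i.e., there is a constant $C>0$ (which may depend on $n$ and $f$ but not on $r$) such that $\overline f^{(r)}-f_{\min}\le C/r^2$ for all integers $r\ge 1$. (ii) For any nonzero linear polynomial $f$ we have $\overline f^{(r)}-f_{\min}=\Omega\left(\frac{1}{r^2}\right)$, i.e., there is a constant $c>0$ (which may depend on $n$ and $f$ but not on $r$) such that $\overline f^{(r)}-f_{\min}\ge c/r^2$ for all integers $r\ge 1$.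
   Context: $\mathbb{S}^{n-1}=\{x\in\mathbb{R}^n:\|x\|=1\}$ is the Euclidean unit sphere and $\sigma$ is its (unnormalized) surface measure, with total mass $\sigma_{n-1}=2\pi^{n/2}/\Gamma(n/2)$. $\Sigma[x]$ is the set of finite sums of squares of real polynomials in $x=(x_1,\dots,x_n)$, and $\Sigma[x]_r$ is the set of polynomials in $\Sigma[x]$ of degree at most $2r$. A nonzero linear polynomial is one of the form $f(x)=c^Tx$ with $c\in\mathbb{R}^n\setminus\{0\}$. *)

theory Defs
  imports "HOL-Analysis.Analysis" "HOL-Library.Poly_Mapping"
begin

section \<open>Real polynomials in the variables indexed by a finite type\<close>

text \<open>
  A monomial is an exponent vector \<^typ>\<open>'n \<Rightarrow>\<^sub>0 nat\<close>. With the convolution product of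
  \<^theory>\<open>HOL-Library.Poly_Mapping\<close>, the type below is the polynomial ring over the reals
  in the \<open>CARD('n)\<close> variables \<open>x $ i\<close>.
\<close>

type_synonym 'n real_mpoly = "('n \<Rightarrow>\<^sub>0 nat) \<Rightarrow>\<^sub>0 real"

definition mpoly_eval :: "'n::finite real_mpoly \<Rightarrow> real ^ 'n \<Rightarrow> real" where
  "mpoly_eval p x =
     (\<Sum>m\<in>Poly_Mapping.keys p.
        Poly_Mapping.lookup p m * (\<Prod>i\<in>UNIV. (x $ i) ^ Poly_Mapping.lookup m i))"

text \<open>The zero polynomial gets degree 0.\<close>

definition total_degree :: "'n::finite real_mpoly \<Rightarrow> nat" where
  "total_degree p =
     Max (insert 0 ((\<lambda>m. \<Sum>i\<in>UNIV. Poly_Mapping.lookup m i) ` Poly_Mapping.keys p))"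

definition mpoly_var :: "'n \<Rightarrow> 'n real_mpoly" where
  "mpoly_var i = Poly_Mapping.single (Poly_Mapping.single i 1) 1"

definition mpoly_const :: "real \<Rightarrow> 'n real_mpoly" where
  "mpoly_const a = Poly_Mapping.single 0 a"

definition nonzero_linear :: "'n::finite real_mpoly \<Rightarrow> bool" where
  "nonzero_linear f \<longleftrightarrow>
     (\<exists>c :: real ^ 'n. c \<noteq> 0 \<and> f = (\<Sum>i\<in>UNIV. mpoly_const (c $ i) * mpoly_var i))"

definition sos :: "'n real_mpoly set" where
  "sos = {h. \<exists>qs. h = (\<Sum>q\<leftarrow>qs. q ^ 2)}"

definition sos_deg :: "nat \<Rightarrow> 'n::finite real_mpoly set" where
  "sos_deg r = {h \<in> sos. total_degree h \<le> 2 * r}"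


section \<open>Surface measure on the unit sphere\<close>

text \<open>
  The surface measure of a Borel set \<open>A\<close> of unit vectors is the dimension times the Lebesgue
  measure of the cone \<open>{t *\<^sub>R u | 0 < t < 1, u \<in> A}\<close>, as in integration in polar coordinates.
  The cone is the preimage of \<open>A\<close> under radial projection of the punctured unit ball.
\<close>

definition sphere_measure :: "'a::euclidean_space measure" where
  "sphere_measure =
     scale_measure (ennreal (real DIM('a)))
       (distr (restrict_space lborel (ball 0 1 - {0})) (restrict_space borel (sphere 0 1))
          (\<lambda>x. x /\<^sub>R norm x))"

lemma space_sphere_measure: "space (sphere_measure :: 'a::euclidean_space measure) = sphere 0 1"
  by (simp add: sphere_measure_def space_scale_measure space_restrict_space)

lemma sets_sphere_measure:
  "sets (sphere_measure :: 'a::euclidean_space measure) = sets (restrict_space borel (sphere 0 1))"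
  by (simp add: sphere_measure_def)

lemma radial_projection_measurable:
  "(\<lambda>x::'a::euclidean_space. x /\<^sub>R norm x)
     \<in> restrict_space lborel (ball 0 1 - {0}) \<rightarrow>\<^sub>M restrict_space borel (sphere 0 1)"
proof (rule measurable_restrict_space3)
  show "(\<lambda>x::'a. x /\<^sub>R norm x) \<in> lborel \<rightarrow>\<^sub>M borel"
    by measurable
qed auto

lemma emeasure_sphere_measure:
  fixes A :: "'a::euclidean_space set"
  assumes A: "A \<in> sets borel" "A \<subseteq> sphere 0 1"
  shows "emeasure sphere_measure A =
           ennreal (real DIM('a)) * emeasure lborel {x \<in> ball 0 1 - {0}. x /\<^sub>R norm x \<in> A}"
proof -
  have "A \<in> sets (restrict_space borel (sphere 0 1))"
    using A by (auto simp: sets_restrict_space)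
  moreover have "(\<lambda>x. x /\<^sub>R norm x) -` A \<inter> space (restrict_space lborel (ball 0 1 - {0}))
      = {x \<in> ball 0 1 - {0}. x /\<^sub>R norm x \<in> A}"
    by (auto simp: space_restrict_space)
  ultimately show ?thesis
    by (simp add: sphere_measure_def emeasure_distr[OF radial_projection_measurable]
        emeasure_restrict_space subset_eq)
qed

lemma emeasure_sphere_measure_sphere:
  "emeasure (sphere_measure :: 'a::euclidean_space measure) (sphere 0 1) =
     ennreal (2 * pi powr (real DIM('a) / 2) / Gamma (real DIM('a) / 2))"
proof -
  let ?n = "real DIM('a)"
  have n: "?n > 0" by simp
  have eq: "{x \<in> ball 0 1 - {0}. x /\<^sub>R norm x \<in> sphere 0 1} = ball (0::'a) 1 - {0}"
    by auto
  have "emeasure lborel (ball (0::'a) 1 - {0}) = emeasure lborel (ball (0::'a) 1)"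
    by (intro emeasure_Diff_null_set) (auto simp: null_sets_def)
  also have "\<dots> = ennreal (unit_ball_vol ?n)"
    by (simp add: emeasure_ball)
  finally have b: "emeasure lborel (ball (0::'a) 1 - {0}) = ennreal (unit_ball_vol ?n)" .
  have "?n / 2 \<notin> \<int>\<^sub>\<le>\<^sub>0"
  proof
    assume "?n / 2 \<in> \<int>\<^sub>\<le>\<^sub>0"
    then have "?n / 2 \<le> 0" by (rule nonpos_Ints_nonpos)
    with n show False by linarith
  qed
  then have "Gamma (?n / 2 + 1) = ?n / 2 * Gamma (?n / 2)"
    by (rule Gamma_plus1)
  moreover have "Gamma (?n / 2) > 0"
    by (rule Gamma_real_pos) (use n in simp)
  moreover have "a * (p / g') = 2 * p / g" if "g' = a / 2 * g" "g > 0" "a > 0" for a p g g' :: real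
    unfolding that(1) using that(2,3) by (simp add: divide_simps)
  ultimately have "?n * unit_ball_vol ?n = 2 * pi powr (?n / 2) / Gamma (?n / 2)"
    unfolding unit_ball_vol_def using n by blast
  moreover have "emeasure (sphere_measure :: 'a measure) (sphere 0 1) = ennreal ?n * ennreal (unit_ball_vol ?n)"
    by (subst emeasure_sphere_measure) (simp_all only: eq b, auto)
  ultimately show ?thesis
    by (simp add: ennreal_mult[symmetric])
qed


section \<open>Minimisation over the sphere and sum-of-squares upper bounds\<close>

text \<open>The minimum exists because the sphere is compact and nonempty.\<close>

definition sphere_min :: "'n::finite real_mpoly \<Rightarrow> real" where
  "sphere_min f = (LEAST v. v \<in> mpoly_eval f ` sphere 0 1)"

definition sos_upper_bound :: "'n::finite real_mpoly \<Rightarrow> nat \<Rightarrow> real" where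
  "sos_upper_bound f r =
     (INF h \<in> {h \<in> sos_deg r. (\<integral>x. mpoly_eval h x \<partial>sphere_measure) = 1}.
        (\<integral>x. mpoly_eval h x * mpoly_eval f x \<partial>sphere_measure))"

end

theory Submission
  imports Defs
begin

text \<open>
  Both rates come down to one question: how small can the mean of \<open>1 - a \<bullet> x\<close> be under a probability density
  on the sphere that is a sum of squares of degree at most \<open>2 * r\<close>, where \<open>a\<close> is a fixed unit vector? On the
  sphere this quantity is half the squared distance to \<open>a\<close>, and the answer is of order \<open>1 / r\<^sup>2\<close>.

  For the upper bound, let \<open>a\<close> be a minimiser of \<open>f\<close>. Comparing \<open>x\<close> with its reflection in the axis through \<open>a\<close>
  cancels first-order terms and gives \<open>f x - f a \<le> L * (1 - a \<bullet> x)\<close> on the sphere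
  (\<open>quadratic_growth_at_minimiser\<close>). It remains to exhibit a good density. A high even power of the Dirichlet
  kernel in the angle from \<open>a\<close>, a Jackson kernel, works: it is large on a cap of angular
  radius about \<open>1 / r\<close> and decays polynomially outside (\<open>kernel_power_concentrates\<close>). The dimension enters only
  through the doubling property of spherical caps (\<open>sphere_cap_doubling\<close>), which follows from the fact that a
  linear bijection changes Lebesgue measure by a constant factor. The power of the kernel is chosen to beat the
  doubling constant.

  For the lower bound with \<open>f\<close> linear, \<open>f x - f a\<close> is a positive multiple of \<open>1 - a \<bullet> x\<close>. Rotate in a plane
  containing \<open>a\<close>. Along each orbit a polynomial of degree \<open>d\<close> is a trigonometric polynomial of degree at most \<open>d\<close>,
  whose mean is computed exactly by any equidistant grid of \<open>M > d\<close> nodes. With \<open>M = 2 * r + 2\<close> nodes,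
  placed symmetrically so as to avoid the direction of \<open>a\<close>, the weight \<open>1 - a \<bullet> x\<close> is at least
  \<open>1 - cos (pi / M)\<close> at every node (\<open>rotation_sum_lower_bound\<close>). Since the density is nonnegative and surface
  measure is rotation invariant, the mean is at least \<open>1 - cos (pi / M)\<close> (\<open>no_concentration\<close>).
\<close>

section \<open>Evaluation and degree of polynomials\<close>

lemma real_mpoly_induct [case_names zero add]:
  fixes p :: "'n::finite real_mpoly"
  assumes "P 0" and step: "\<And>p m c. P p \<Longrightarrow> P (Poly_Mapping.single m c + p)"
  shows "P p"
proof (induction p rule: Poly_Mapping.update_induct)
  case const
  show ?case by fact
next
  case (update p m c)
  have "Poly_Mapping.update m c p = Poly_Mapping.single m c + p"
    using \<open>m \<notin> Poly_Mapping.keys p\<close>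
    by (intro poly_mapping_eqI)
       (auto simp: lookup_update lookup_add lookup_single when_def in_keys_iff)
  then show ?case
    using step[OF update.IH] by simp
qed

lemma mpoly_eval_0 [simp]: "mpoly_eval 0 x = 0"
  by (simp add: mpoly_eval_def)

lemma mpoly_eval_single:
  "mpoly_eval (Poly_Mapping.single m c) x = c * (\<Prod>i\<in>UNIV. (x $ i) ^ Poly_Mapping.lookup m i)"
  by (simp add: mpoly_eval_def)

lemma mpoly_eval_add [simp]: "mpoly_eval (p + q) x = mpoly_eval p x + mpoly_eval q x"
  unfolding mpoly_eval_def
  by (rule setsum_keys_plus_distrib) (auto simp: algebra_simps)

lemma mpoly_eval_mult [simp]: "mpoly_eval (p * q) x = mpoly_eval p x * mpoly_eval q x"
proof (induction p rule: real_mpoly_induct)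
  case (add p m c)
  have "mpoly_eval (Poly_Mapping.single m c * q) x = mpoly_eval (Poly_Mapping.single m c) x * mpoly_eval q x"
    by (induction q rule: real_mpoly_induct)
       (simp_all add: mult_single mpoly_eval_single lookup_add power_add prod.distrib
         distrib_left mult_ac)
  then show ?case
    by (simp add: distrib_right add)
qed simp

lemma mpoly_eval_const [simp]: "mpoly_eval (mpoly_const a) x = a"
  by (simp add: mpoly_const_def mpoly_eval_single)

lemma mpoly_eval_var [simp]: "mpoly_eval (mpoly_var i) x = x $ i"
proof -
  have "(\<Prod>j\<in>UNIV. (x $ j) ^ Poly_Mapping.lookup (Poly_Mapping.single i (1::nat)) j)
      = (\<Prod>j\<in>UNIV. if j = i then x $ i else 1)"
    by (intro prod.cong) (auto simp: lookup_single when_def)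
  then show ?thesis
    by (simp add: mpoly_var_def mpoly_eval_single)
qed

lemma mpoly_eval_1 [simp]: "mpoly_eval 1 x = 1"
  by (simp flip: single_one add: mpoly_eval_single)

lemma mpoly_eval_sum [simp]: "mpoly_eval (\<Sum>i\<in>A. p i) x = (\<Sum>i\<in>A. mpoly_eval (p i) x)"
  by (induction A rule: infinite_finite_induct) simp_all

lemma mpoly_eval_power [simp]: "mpoly_eval (p ^ k) x = mpoly_eval p x ^ k"
  by (induction k) simp_all

lemma mpoly_eval_sum_list: "mpoly_eval (\<Sum>q\<leftarrow>qs. g q) x = (\<Sum>q\<leftarrow>qs. mpoly_eval (g q) x)"
  by (induction qs) simp_all

lemma mpoly_eval_sos_nonneg: "h \<in> sos \<Longrightarrow> mpoly_eval h x \<ge> 0"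
  by (auto simp: sos_def mpoly_eval_sum_list intro!: sum_list_nonneg)

lemma power2_in_sos: "q ^ 2 \<in> sos"
  by (auto simp: sos_def intro: exI[of _ "[q]"])

lemma continuous_on_mpoly_eval [continuous_intros]:
  "continuous_on A g \<Longrightarrow> continuous_on A (\<lambda>x. mpoly_eval p (g x))"
  unfolding mpoly_eval_def by (intro continuous_intros)

lemma total_degree_le_iff:
  "total_degree p \<le> d \<longleftrightarrow> (\<forall>m\<in>Poly_Mapping.keys p. (\<Sum>i\<in>UNIV. Poly_Mapping.lookup m i) \<le> d)"
  by (simp add: total_degree_def)

lemma total_degree_add:
  assumes "total_degree p \<le> d" "total_degree q \<le> d"
  shows "total_degree (p + q) \<le> d"
  using assms keys_add[of p q] unfolding total_degree_le_iff by blast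

lemma total_degree_sum:
  "(\<And>i. i \<in> A \<Longrightarrow> total_degree (p i) \<le> d) \<Longrightarrow> total_degree (\<Sum>i\<in>A. p i) \<le> d"
proof (induction A rule: infinite_finite_induct)
  case (insert i A)
  then show ?case by (simp add: total_degree_add)
qed (simp_all add: total_degree_def)

lemma total_degree_mult:
  assumes "total_degree p \<le> d" "total_degree q \<le> e"
  shows "total_degree (p * q) \<le> d + e"
  unfolding total_degree_le_iff
proof
  fix m assume "m \<in> Poly_Mapping.keys (p * q)"
  then obtain a b where "m = a + b" "a \<in> Poly_Mapping.keys p" "b \<in> Poly_Mapping.keys q"
    using keys_mult[of p q] by blast
  then show "(\<Sum>i\<in>UNIV. Poly_Mapping.lookup m i) \<le> d + e"
    using assms unfolding total_degree_le_iff
    by (simp add: lookup_add sum.distrib add_mono)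
qed

lemma total_degree_const [simp]: "total_degree (mpoly_const a) = 0"
  by (simp add: total_degree_def mpoly_const_def)

lemma total_degree_var: "total_degree (mpoly_var i) \<le> 1"
  by (auto simp: total_degree_le_iff mpoly_var_def lookup_single when_def)

lemma total_degree_power: "total_degree p \<le> d \<Longrightarrow> total_degree (p ^ k) \<le> d * k"
proof (induction k)
  case 0
  then show ?case by (simp add: total_degree_def)
next
  case (Suc k)
  then show ?case using total_degree_mult[of p d "p ^ k" "d * k"] by simp
qed

definition linear_mpoly :: "real ^ 'n \<Rightarrow> 'n::finite real_mpoly" where
  "linear_mpoly c = (\<Sum>i\<in>UNIV. mpoly_const (c $ i) * mpoly_var i)"

lemma mpoly_eval_linear [simp]: "mpoly_eval (linear_mpoly c) x = c \<bullet> x"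
  by (simp add: linear_mpoly_def inner_vec_def)

lemma total_degree_linear: "total_degree (linear_mpoly c) \<le> 1"
  unfolding linear_mpoly_def
proof (rule total_degree_sum)
  fix i show "total_degree (mpoly_const (c $ i) * mpoly_var i) \<le> 1"
    using total_degree_mult[of "mpoly_const (c $ i)" 0 "mpoly_var i" 1] total_degree_var[of i]
    by simp
qed

lemma sphere_min_attained:
  fixes f :: "'n::finite real_mpoly"
  obtains a where "norm a = 1" "mpoly_eval f a = sphere_min f"
    and "\<And>x. norm x = 1 \<Longrightarrow> sphere_min f \<le> mpoly_eval f x"
proof -
  obtain a where a: "a \<in> sphere 0 1" "\<And>x. x \<in> sphere 0 1 \<Longrightarrow> mpoly_eval f a \<le> mpoly_eval f x"
    using continuous_attains_inf[of "sphere (0::real ^ 'n) 1" "mpoly_eval f"]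
      continuous_on_mpoly_eval[OF continuous_on_id, of _ f] by auto
  have "sphere_min f = mpoly_eval f a"
    unfolding sphere_min_def by (rule Least_equality) (use a in auto)
  then show ?thesis using a by (intro that[of a]) auto
qed

section \<open>Quadratic growth away from a minimiser\<close>

text \<open>
  The reflection of \<open>x\<close> in the axis through \<open>a\<close> is \<open>(2 * (a \<bullet> x)) *\<^sub>R a - x\<close>, so the second clause
  bounds a second difference centred at \<open>a\<close>, in which first-order terms cancel. On the sphere \<open>1 - a \<bullet> x\<close> is half the squared distance
  from \<open>x\<close> to \<open>a\<close>; the first clause is a Lipschitz bound, which makes the class closed under products.
\<close>

definition axially_quadratic :: "real ^ 'n \<Rightarrow> (real ^ 'n::finite \<Rightarrow> real) \<Rightarrow> bool" where
  "axially_quadratic a g \<longleftrightarrow>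
     (\<exists>L. (\<forall>x. norm x = 1 \<longrightarrow> (g x - g a)\<^sup>2 \<le> L * (1 - a \<bullet> x))
        \<and> (\<forall>x. norm x = 1 \<longrightarrow>
             \<bar>g x + g ((2 * (a \<bullet> x)) *\<^sub>R a - x) - 2 * g a\<bar> \<le> L * (1 - a \<bullet> x)))"

lemma axial_reflection:
  fixes a x :: "'a::real_inner"
  assumes "norm a = 1"
  shows norm_axial_reflection: "norm ((2 * (a \<bullet> x)) *\<^sub>R a - x) = norm x"
    and inner_axial_reflection: "a \<bullet> ((2 * (a \<bullet> x)) *\<^sub>R a - x) = a \<bullet> x"
proof -
  have aa: "a \<bullet> a = 1" using assms by (simp add: norm_eq_1)
  then show "a \<bullet> ((2 * (a \<bullet> x)) *\<^sub>R a - x) = a \<bullet> x"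
    by (simp add: inner_diff_right)
  show "norm ((2 * (a \<bullet> x)) *\<^sub>R a - x) = norm x"
    by (simp add: norm_eq_sqrt_inner inner_diff_left inner_diff_right aa inner_commute algebra_simps)
qed

lemma inner_le_1_of_unit: "norm a = 1 \<Longrightarrow> norm x = 1 \<Longrightarrow> a \<bullet> x \<le> (1::real)"
  using norm_cauchy_schwarz[of a x] by simp

text \<open>
  With \<open>A = f x - f a\<close> and \<open>B = g x - g a\<close> one has \<open>f x * g x - f a * g a = f a * B + g a * A + A * B\<close>.
  Adding the same identity at the reflected point, the terms linear in \<open>A\<close> and \<open>B\<close> become second
  differences, while the products \<open>A * B\<close> are of quadratic size by the Lipschitz clause.
\<close>

lemma axially_quadratic_mult:
  assumes a: "norm a = 1" and "axially_quadratic a f" "axially_quadratic a g"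
  shows "axially_quadratic a (\<lambda>x. f x * g x)"
proof -
  obtain K where K: "\<And>x. norm x = 1 \<Longrightarrow> (f x - f a)\<^sup>2 \<le> K * (1 - a \<bullet> x)"
     "\<And>x. norm x = 1 \<Longrightarrow> \<bar>f x + f ((2 * (a \<bullet> x)) *\<^sub>R a - x) - 2 * f a\<bar> \<le> K * (1 - a \<bullet> x)"
    using assms(2) unfolding axially_quadratic_def by blast
  obtain L where L: "\<And>x. norm x = 1 \<Longrightarrow> (g x - g a)\<^sup>2 \<le> L * (1 - a \<bullet> x)"
     "\<And>x. norm x = 1 \<Longrightarrow> \<bar>g x + g ((2 * (a \<bullet> x)) *\<^sub>R a - x) - 2 * g a\<bar> \<le> L * (1 - a \<bullet> x)"
    using assms(3) unfolding axially_quadratic_def by blast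
  have KL0: "K \<ge> 0" "L \<ge> 0"
    using K(2)[of "-a"] L(2)[of "-a"] a by (simp_all add: norm_eq_1)
  define M where "M = K + L + \<bar>f a\<bar> * L + \<bar>g a\<bar> * K"
  define M2 where "M2 = 3 * ((f a)\<^sup>2 * L + (g a)\<^sup>2 * K + 2 * K * L)"
  have first: "(f x * g x - f a * g a)\<^sup>2 \<le> M2 * (1 - a \<bullet> x)" if x: "norm x = 1" for x
  proof -
    let ?u = "1 - a \<bullet> x"
    have u: "0 \<le> ?u" "?u \<le> 2"
      using inner_le_1_of_unit[OF a x] inner_le_1_of_unit[of "-a" x] a x by auto
    define A B where "A = f x - f a" and "B = g x - g a"
    have AB: "A\<^sup>2 \<le> K * ?u" "B\<^sup>2 \<le> L * ?u" using K(1)[OF x] L(1)[OF x] by (simp_all add: A_def B_def)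
    have "A\<^sup>2 * B\<^sup>2 \<le> (K * ?u) * (L * ?u)" by (intro mult_mono AB) (use KL0 u in auto)
    also have "\<dots> = K * L * ?u * ?u" by simp
    also have "\<dots> \<le> K * L * ?u * 2" by (intro mult_left_mono) (use KL0 u in auto)
    finally have "A\<^sup>2 * B\<^sup>2 \<le> K * L * ?u * 2" .
    moreover have "(f a)\<^sup>2 * B\<^sup>2 \<le> (f a)\<^sup>2 * (L * ?u)" "(g a)\<^sup>2 * A\<^sup>2 \<le> (g a)\<^sup>2 * (K * ?u)"
      by (intro mult_left_mono AB; simp)+
    moreover have "(p + q + r)\<^sup>2 \<le> 3 * (p\<^sup>2 + q\<^sup>2 + r\<^sup>2)" for p q r :: real
      using zero_le_power2[of "p - q"] zero_le_power2[of "q - r"] zero_le_power2[of "p - r"]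
      by (simp add: power2_eq_square algebra_simps)
    from this[of "f a * B" "g a * A" "A * B"]
    have "(f a * B + g a * A + A * B)\<^sup>2 \<le> 3 * ((f a)\<^sup>2 * B\<^sup>2 + (g a)\<^sup>2 * A\<^sup>2 + A\<^sup>2 * B\<^sup>2)"
      by (simp add: power_mult_distrib)
    moreover have "f x * g x - f a * g a = f a * B + g a * A + A * B"
      by (simp add: A_def B_def algebra_simps)
    ultimately show ?thesis by (simp add: M2_def algebra_simps)
  qed
  have second: "\<bar>f x * g x + f y * g y - 2 * (f a * g a)\<bar> \<le> M * (1 - a \<bullet> x)"
    if x: "norm x = 1" and y: "y = (2 * (a \<bullet> x)) *\<^sub>R a - x" for x y
  proof -
    let ?u = "1 - a \<bullet> x"
    have y1: "norm y = 1" "a \<bullet> y = a \<bullet> x" using axial_reflection[OF a, of x] x y by auto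
    define A B where "A = f x - f a" and "B = g x - g a"
    define A' B' where "A' = f y - f a" and "B' = g y - g a"
    have AB: "A\<^sup>2 \<le> K * ?u" "B\<^sup>2 \<le> L * ?u" "A'\<^sup>2 \<le> K * ?u" "B'\<^sup>2 \<le> L * ?u"
      using K(1)[OF x] L(1)[OF x] K(1)[OF y1(1)] L(1)[OF y1(1)] y1
      by (simp_all add: A_def B_def A'_def B'_def)
    have young: "\<bar>p * q\<bar> \<le> (p\<^sup>2 + q\<^sup>2) / 2" for p q :: real
      using zero_le_power2[of "\<bar>p\<bar> - \<bar>q\<bar>"] by (simp add: power2_eq_square algebra_simps abs_mult)
    have "A + A' = f x + f y - 2 * f a" "B + B' = g x + g y - 2 * g a"
      by (simp_all add: A_def B_def A'_def B'_def)
    then have "\<bar>B + B'\<bar> \<le> L * ?u" "\<bar>A + A'\<bar> \<le> K * ?u"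
      using K(2)[OF x] L(2)[OF x] by (simp_all only: y)
    then have "\<bar>f a * (B + B')\<bar> \<le> \<bar>f a\<bar> * (L * ?u)" "\<bar>g a * (A + A')\<bar> \<le> \<bar>g a\<bar> * (K * ?u)"
      unfolding abs_mult by (auto intro!: mult_left_mono)
    moreover have "\<bar>A * B\<bar> \<le> (K * ?u + L * ?u) / 2" "\<bar>A' * B'\<bar> \<le> (K * ?u + L * ?u) / 2"
      using young[of A B] young[of A' B'] AB by auto
    moreover have "f x * g x + f y * g y - 2 * (f a * g a)
        = f a * (B + B') + g a * (A + A') + A * B + A' * B'"
      by (simp add: A_def B_def A'_def B'_def algebra_simps)
    moreover have "M * ?u = (K * ?u + L * ?u) / 2 + (K * ?u + L * ?u) / 2 + \<bar>f a\<bar> * (L * ?u) + \<bar>g a\<bar> * (K * ?u)"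
      by (simp add: M_def algebra_simps)
    ultimately show ?thesis by linarith
  qed
  have "M * (1 - a \<bullet> x) \<le> max M M2 * (1 - a \<bullet> x)" "M2 * (1 - a \<bullet> x) \<le> max M M2 * (1 - a \<bullet> x)"
    if "norm x = 1" for x
    using inner_le_1_of_unit[OF a that] by (auto intro!: mult_right_mono)
  then show ?thesis
    using first second unfolding axially_quadratic_def
    by (intro exI[of _ "max M M2"]) (meson order_trans)
qed

lemma axially_quadratic_add:
  assumes a: "norm a = 1" and "axially_quadratic a f" "axially_quadratic a g"
  shows "axially_quadratic a (\<lambda>x. f x + g x)"
proof -
  obtain K where K: "\<And>x. norm x = 1 \<Longrightarrow> (f x - f a)\<^sup>2 \<le> K * (1 - a \<bullet> x)"
     "\<And>x. norm x = 1 \<Longrightarrow> \<bar>f x + f ((2 * (a \<bullet> x)) *\<^sub>R a - x) - 2 * f a\<bar> \<le> K * (1 - a \<bullet> x)"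
    using assms(2) unfolding axially_quadratic_def by blast
  obtain L where L: "\<And>x. norm x = 1 \<Longrightarrow> (g x - g a)\<^sup>2 \<le> L * (1 - a \<bullet> x)"
     "\<And>x. norm x = 1 \<Longrightarrow> \<bar>g x + g ((2 * (a \<bullet> x)) *\<^sub>R a - x) - 2 * g a\<bar> \<le> L * (1 - a \<bullet> x)"
    using assms(3) unfolding axially_quadratic_def by blast
  have KL0: "0 \<le> K" "0 \<le> L"
    using K(2)[of "-a"] L(2)[of "-a"] a by (simp_all add: norm_eq_1)
  have "(f x + g x - (f a + g a))\<^sup>2 \<le> 2 * (K + L) * (1 - a \<bullet> x)"
    and "\<bar>f x + g x + (f y + g y) - 2 * (f a + g a)\<bar> \<le> 2 * (K + L) * (1 - a \<bullet> x)"
    if x: "norm x = 1" and y: "y = (2 * (a \<bullet> x)) *\<^sub>R a - x" for x y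
  proof -
    have "(p + q)\<^sup>2 \<le> 2 * (p\<^sup>2 + q\<^sup>2)" for p q :: real
      using zero_le_power2[of "p - q"] by (simp add: power2_eq_square algebra_simps)
    from this[of "f x - f a" "g x - g a"]
    have "(f x - f a + (g x - g a))\<^sup>2 \<le> 2 * ((f x - f a)\<^sup>2 + (g x - g a)\<^sup>2)" .
    also have "\<dots> \<le> 2 * (K * (1 - a \<bullet> x) + L * (1 - a \<bullet> x))"
      by (intro mult_left_mono add_mono K(1)[OF x] L(1)[OF x]) simp
    finally have "(f x - f a + (g x - g a))\<^sup>2 \<le> 2 * (K * (1 - a \<bullet> x) + L * (1 - a \<bullet> x))" .
    moreover have "f x + g x - (f a + g a) = f x - f a + (g x - g a)" by simp
    ultimately show "(f x + g x - (f a + g a))\<^sup>2 \<le> 2 * (K + L) * (1 - a \<bullet> x)"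
      by (simp only: distrib_right mult.assoc)
    have "0 \<le> K * (1 - a \<bullet> x)" "0 \<le> L * (1 - a \<bullet> x)"
      using KL0 inner_le_1_of_unit[OF a x] by auto
    moreover have "\<bar>f x + f y - 2 * f a\<bar> \<le> K * (1 - a \<bullet> x)" "\<bar>g x + g y - 2 * g a\<bar> \<le> L * (1 - a \<bullet> x)"
      using K(2)[OF x] L(2)[OF x] by (simp_all only: y)
    moreover have "\<bar>p + q\<bar> \<le> 2 * A + 2 * B" if "0 \<le> A" "0 \<le> B" "\<bar>p\<bar> \<le> A" "\<bar>q\<bar> \<le> B" for p q A B :: real
      using that by linarith
    ultimately have "\<bar>(f x + f y - 2 * f a) + (g x + g y - 2 * g a)\<bar> \<le> 2 * (K * (1 - a \<bullet> x)) + 2 * (L * (1 - a \<bullet> x))"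
      by blast
    moreover have "(f x + f y - 2 * f a) + (g x + g y - 2 * g a) = f x + g x + (f y + g y) - 2 * (f a + g a)"
      by (simp add: algebra_simps)
    ultimately show "\<bar>f x + g x + (f y + g y) - 2 * (f a + g a)\<bar> \<le> 2 * (K + L) * (1 - a \<bullet> x)"
      by (simp add: algebra_simps)
  qed
  then show ?thesis
    unfolding axially_quadratic_def by blast
qed

lemma axially_quadratic_const: "norm a = 1 \<Longrightarrow> axially_quadratic a (\<lambda>x. c)"
  unfolding axially_quadratic_def by (rule exI[of _ 0]) simp

lemma axially_quadratic_coordinate:
  assumes a: "norm a = 1"
  shows "axially_quadratic a (\<lambda>x. x $ i)"
  unfolding axially_quadratic_def
proof (intro exI[of _ 2] conjI allI impI)
  fix x :: "real ^ 'a" assume x: "norm x = 1"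
  have "\<bar>x $ i - a $ i\<bar> \<le> norm (x - a)"
    using component_le_norm_cart[of "x - a" i] by simp
  then have "(x $ i - a $ i)\<^sup>2 \<le> (norm (x - a))\<^sup>2"
    by (metis abs_le_square_iff abs_norm_cancel)
  also have "\<dots> = 2 * (1 - a \<bullet> x)"
    using a x by (simp add: power2_norm_eq_inner inner_diff norm_eq_1 inner_commute algebra_simps)
  finally show "(x $ i - a $ i)\<^sup>2 \<le> 2 * (1 - a \<bullet> x)" .
  have "x $ i + ((2 * (a \<bullet> x)) *\<^sub>R a - x) $ i - 2 * a $ i = - (2 * (1 - a \<bullet> x)) * a $ i"
    by (simp add: algebra_simps)
  moreover have "\<bar>- (2 * (1 - a \<bullet> x)) * a $ i\<bar> \<le> \<bar>- (2 * (1 - a \<bullet> x))\<bar> * 1"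
    unfolding abs_mult using component_le_norm_cart[of a i] a by (intro mult_left_mono) auto
  ultimately show "\<bar>x $ i + ((2 * (a \<bullet> x)) *\<^sub>R a - x) $ i - 2 * a $ i\<bar> \<le> 2 * (1 - a \<bullet> x)"
    using inner_le_1_of_unit[OF a x] by auto
qed

lemma axially_quadratic_mpoly_eval:
  fixes f :: "'n::finite real_mpoly"
  assumes a: "norm a = 1"
  shows "axially_quadratic a (mpoly_eval f)"
proof (induction f rule: real_mpoly_induct)
  case zero
  then show ?case using axially_quadratic_const[OF a, of 0] by (simp add: axially_quadratic_def)
next
  case (add p m c)
  have pow: "axially_quadratic a (\<lambda>x. (x $ i) ^ k)" for i k
    by (induction k)
       (simp_all add: axially_quadratic_const axially_quadratic_mult axially_quadratic_coordinate a)
  have "axially_quadratic a (\<lambda>x. \<Prod>i\<in>A. (x $ i) ^ Poly_Mapping.lookup m i)" for A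
    by (induction A rule: infinite_finite_induct)
       (simp_all add: axially_quadratic_const axially_quadratic_mult a pow)
  then have "axially_quadratic a (\<lambda>x. c * (\<Prod>i\<in>UNIV. (x $ i) ^ Poly_Mapping.lookup m i))"
    by (intro axially_quadratic_mult axially_quadratic_const a)
  then have "axially_quadratic a (\<lambda>x. mpoly_eval (Poly_Mapping.single m c) x + mpoly_eval p x)"
    by (intro axially_quadratic_add a add) (simp add: mpoly_eval_single)
  then show ?case by (simp add: axially_quadratic_def)
qed

text \<open>
  The value at the reflected point is at least the minimum, so \<open>f x - f a\<close> is at most
  the second difference centred at \<open>a\<close>.
\<close>

lemma quadratic_growth_at_minimiser:
  fixes f :: "'n::finite real_mpoly"
  assumes a: "norm a = 1" and "\<And>x. norm x = 1 \<Longrightarrow> mpoly_eval f a \<le> mpoly_eval f x"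
  obtains L where "L > 0" "\<And>x. norm x = 1 \<Longrightarrow> mpoly_eval f x - mpoly_eval f a \<le> L * (1 - a \<bullet> x)"
proof -
  obtain L where L: "\<And>x. norm x = 1 \<Longrightarrow> \<bar>mpoly_eval f x + mpoly_eval f ((2 * (a \<bullet> x)) *\<^sub>R a - x) - 2 * mpoly_eval f a\<bar>
      \<le> L * (1 - a \<bullet> x)"
    using axially_quadratic_mpoly_eval[OF a, of f] unfolding axially_quadratic_def by blast
  show thesis
  proof (rule that[of "max L 1"])
    fix x :: "real ^ 'n" assume x: "norm x = 1"
    have "mpoly_eval f a \<le> mpoly_eval f ((2 * (a \<bullet> x)) *\<^sub>R a - x)"
      using assms(2) axial_reflection[OF a, of x] x by simp
    then have "mpoly_eval f x - mpoly_eval f a \<le> L * (1 - a \<bullet> x)"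
      using L[OF x] by linarith
    also have "\<dots> \<le> max L 1 * (1 - a \<bullet> x)"
      using inner_le_1_of_unit[OF a x] by (intro mult_right_mono) auto
    finally show "mpoly_eval f x - mpoly_eval f a \<le> max L 1 * (1 - a \<bullet> x)" .
  qed simp
qed

section \<open>Lebesgue measure under linear bijections\<close>

lemma nn_integral_lborel_add:
  fixes f :: "'a::euclidean_space \<Rightarrow> ennreal"
  assumes [measurable]: "f \<in> borel_measurable borel"
  shows "(\<integral>\<^sup>+x. f (c + x) \<partial>lborel) = (\<integral>\<^sup>+x. f x \<partial>lborel)"
proof -
  have "(\<integral>\<^sup>+x. f x \<partial>lborel) = (\<integral>\<^sup>+x. f x \<partial>distr lborel borel ((+) c))"
    by (simp add: lborel_distr_plus)
  also have "\<dots> = (\<integral>\<^sup>+x. f (c + x) \<partial>lborel)"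
    by (rule nn_integral_distr) auto
  finally show ?thesis by simp
qed

lemma nn_integral_lborel_reflect:
  fixes f :: "'a::euclidean_space \<Rightarrow> ennreal"
  assumes [measurable]: "f \<in> borel_measurable borel"
  shows "(\<integral>\<^sup>+x. f (c - x) \<partial>lborel) = (\<integral>\<^sup>+x. f x \<partial>lborel)"
proof -
  have "(lborel :: 'a measure) = distr lborel borel (\<lambda>x. c - x)"
    using lborel_affine[of "-1" c] by (simp add: density_1)
  then have "(\<integral>\<^sup>+x. f x \<partial>lborel) = (\<integral>\<^sup>+x. f x \<partial>distr lborel borel (\<lambda>x. c - x))"
    by simp
  also have "\<dots> = (\<integral>\<^sup>+x. f (c - x) \<partial>lborel)"
    by (rule nn_integral_distr) auto
  finally show ?thesis by simp
qed

text \<open>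
  Uniqueness of translation-invariant measure, in the form needed here: the measure \<open>A \<mapsto> \<lambda>(T -` A)\<close> is
  proportional to Lebesgue measure. Both sides are the integral of
  \<open>indicator A (T y + x) * indicator B (T y)\<close> over all pairs \<open>(x, y)\<close>, evaluated in the two orders; a
  translation of \<open>y\<close> turns the integrand into \<open>indicator A (T y) * indicator B (T y - x)\<close>. The factor
  of proportionality is read off by taking a ball for \<open>B\<close>.
\<close>

lemma emeasure_lborel_linear_vimage:
  fixes T T' :: "'a::euclidean_space \<Rightarrow> 'a"
  assumes T: "linear T" and inv: "\<And>x. T (T' x) = x"
    and [measurable]: "A \<in> sets borel" "B \<in> sets borel"
  shows "emeasure lborel A * emeasure lborel (T -` B) = emeasure lborel (T -` A) * emeasure lborel B"
proof -
  have [measurable]: "T \<in> borel_measurable borel"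
    using T by (intro borel_measurable_continuous_onI linear_continuous_on linear_linear[THEN iffD1])
               (simp add: linear_conv_bounded_linear)
  have [measurable]: "T -` C \<in> sets borel" if "C \<in> sets borel" for C
    using measurable_sets[of T borel borel C] that by simp
  have *: "(\<integral>\<^sup>+x. indicator A x \<partial>lborel) * indicator B (T y)
      = (\<integral>\<^sup>+x. indicator A (T y + x) * indicator B (T y) \<partial>lborel)" for y
    using nn_integral_lborel_add[of "indicator A" "T y"] by (simp add: nn_integral_multc)
  have **: "(\<integral>\<^sup>+y. indicator A (T y + x) * indicator B (T y) \<partial>lborel)
      = (\<integral>\<^sup>+y. indicator A (T y) * indicator B (T y - x) \<partial>lborel)" for x
    using nn_integral_lborel_add[of "\<lambda>y. indicator A (T y) * indicator B (T y - x)" "T' x", symmetric]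
    by (simp add: linear_add[OF T] inv add.commute)
  have ***: "(\<integral>\<^sup>+x. indicator A (T y) * indicator B (T y - x) \<partial>lborel)
      = indicator A (T y) * (\<integral>\<^sup>+x. indicator B x \<partial>lborel)" for y
    using nn_integral_lborel_reflect[of "indicator B" "T y"] by (simp add: nn_integral_cmult)
  have ind: "emeasure lborel (T -` C) = (\<integral>\<^sup>+y. indicator C (T y) \<partial>lborel)" if [measurable]: "C \<in> sets borel" for C
  proof -
    have "(\<integral>\<^sup>+y. indicator C (T y) \<partial>lborel) = (\<integral>\<^sup>+y. indicator (T -` C) y \<partial>lborel)"
      by (intro nn_integral_cong) (simp add: indicator_def)
    then show ?thesis by simp
  qed
  have "emeasure lborel A * emeasure lborel (T -` B)
      = (\<integral>\<^sup>+y. (\<integral>\<^sup>+x. indicator A x \<partial>lborel) * indicator B (T y) \<partial>lborel)"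
    by (simp add: ind nn_integral_cmult)
  also have "\<dots> = (\<integral>\<^sup>+y. \<integral>\<^sup>+x. indicator A (T y + x) * indicator B (T y) \<partial>lborel \<partial>lborel)"
    by (simp only: *)
  also have "\<dots> = (\<integral>\<^sup>+x. \<integral>\<^sup>+y. indicator A (T y + x) * indicator B (T y) \<partial>lborel \<partial>lborel)"
    by (rule lborel_pair.Fubini') measurable
  also have "\<dots> = (\<integral>\<^sup>+x. \<integral>\<^sup>+y. indicator A (T y) * indicator B (T y - x) \<partial>lborel \<partial>lborel)"
    by (simp only: **)
  also have "\<dots> = (\<integral>\<^sup>+y. \<integral>\<^sup>+x. indicator A (T y) * indicator B (T y - x) \<partial>lborel \<partial>lborel)"
    by (rule lborel_pair.Fubini') measurable
  also have "\<dots> = emeasure lborel (T -` A) * emeasure lborel B"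
    by (simp add: *** ind nn_integral_multc)
  finally show ?thesis .
qed

lemma emeasure_lborel_ball_pos: "0 < r \<Longrightarrow> 0 < emeasure lborel (ball (c::'a::euclidean_space) r)"
  by (simp add: emeasure_ball unit_ball_vol_pos)

lemma emeasure_lborel_linear_vimage_le:
  fixes T T' :: "'a::euclidean_space \<Rightarrow> 'a"
  assumes T: "linear T" and T': "linear T'" and inv: "\<And>x. T (T' x) = x"
  obtains D :: real where "D > 0"
    "\<And>A. A \<in> sets borel \<Longrightarrow> emeasure lborel (T -` A) \<le> ennreal D * emeasure lborel A"
proof -
  let ?B = "ball (0::'a) 1"
  obtain b' where b': "b' > 0" "\<And>x. norm (T' x) \<le> b' * norm x"
    using linear_bounded_pos[OF T'] by blast
  have bij: "T' (T x) = x" for x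
  proof -
    have "surj T" using inv by (metis surjI)
    then have "inj T" using T linear_surj_imp_inj by blast
    then show ?thesis using inv by (metis injD)
  qed
  have "T -` ?B \<subseteq> cball 0 b'"
  proof
    fix x assume "x \<in> T -` ?B"
    then have "b' * norm (T x) \<le> b' * 1" using b'(1) by (intro mult_left_mono) auto
    then show "x \<in> cball 0 b'" using b'(2)[of "T x"] by (simp add: bij)
  qed
  then have "emeasure lborel (T -` ?B) \<le> emeasure lborel (cball (0::'a) b')"
    by (intro emeasure_mono) auto
  also have "\<dots> < \<infinity>" using emeasure_lborel_cball_finite[of 0 b'] by (simp add: top.not_eq_extremum)
  finally have fin: "emeasure lborel (T -` ?B) < \<infinity>" .
  have B: "0 < emeasure lborel ?B" "emeasure lborel ?B < \<infinity>"
    using emeasure_lborel_ball_pos[of 1 0] emeasure_lborel_ball_finite[of 0 1] by (simp_all add: top.not_eq_extremum)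
  define p q where "p = enn2real (emeasure lborel (T -` ?B))" and "q = enn2real (emeasure lborel ?B)"
  have pq: "emeasure lborel (T -` ?B) = ennreal p" "emeasure lborel ?B = ennreal q" "0 \<le> p" "0 < q"
    using fin B by (simp_all add: p_def q_def enn2real_positive_iff)
  show thesis
  proof (rule that[of "p / q + 1"])
    show "0 < p / q + 1" using pq by (simp add: add_nonneg_pos)
    fix A :: "'a set" assume A: "A \<in> sets borel"
    have "emeasure lborel (T -` A) = emeasure lborel (T -` A) * ennreal q * ennreal (1 / q)"
      using pq by (simp add: mult.assoc ennreal_mult[symmetric])
    also have "\<dots> = emeasure lborel A * ennreal p * ennreal (1 / q)"
      using emeasure_lborel_linear_vimage[OF T inv A, of ?B] by (simp add: pq)
    also have "\<dots> = emeasure lborel A * ennreal (p / q)"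
      using pq by (simp add: mult.assoc ennreal_mult[symmetric])
    also have "\<dots> \<le> emeasure lborel A * ennreal (p / q + 1)"
      by (intro mult_left_mono ennreal_leI) auto
    finally show "emeasure lborel (T -` A) \<le> ennreal (p / q + 1) * emeasure lborel A"
      by (simp add: mult.commute)
  qed
qed

text \<open>
  An orthogonal map preserves the unit ball, so its factor of proportionality is 1.
\<close>

lemma emeasure_lborel_orthogonal_vimage:
  fixes T :: "'a::euclidean_space \<Rightarrow> 'a"
  assumes T: "orthogonal_transformation T" and A: "A \<in> sets borel"
  shows "emeasure lborel (T -` A) = emeasure lborel A"
proof -
  let ?B = "ball (0::'a) 1"
  have "T -` ?B = ?B"
    using orthogonal_transformation_norm[OF T] by auto
  moreover have "T (inv T x) = x" for x
    using orthogonal_transformation_surj[OF T] by (simp add: surj_f_inv_f)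
  ultimately have "emeasure lborel A * emeasure lborel ?B = emeasure lborel (T -` A) * emeasure lborel ?B"
    using emeasure_lborel_linear_vimage[OF orthogonal_transformation_linear[OF T], of "inv T" A ?B] A by simp
  moreover have "0 < emeasure lborel ?B" "emeasure lborel ?B < \<infinity>"
    using emeasure_lborel_ball_pos[of 1 0] emeasure_lborel_ball_finite[of 0 1] by (simp_all add: top.not_eq_extremum)
  ultimately show ?thesis
    using ennreal_mult_cancel_left[of "emeasure lborel ?B" "emeasure lborel A" "emeasure lborel (T -` A)"]
    by (auto simp: mult.commute)
qed

section \<open>Integration against surface measure\<close>

lemma sets_sphere_measureD:
  assumes "A \<in> sets (sphere_measure :: 'a::euclidean_space measure)"
  shows "A \<in> sets borel" "A \<subseteq> sphere 0 1"
  using assms by (auto simp: sets_sphere_measure sets_restrict_space)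

lemma sets_sphere_measureI:
  "A \<in> sets borel \<Longrightarrow> A \<subseteq> sphere 0 1 \<Longrightarrow> A \<in> sets (sphere_measure :: 'a::euclidean_space measure)"
  by (auto simp: sets_sphere_measure sets_restrict_space)

lemma finite_sphere_measure: "finite_measure (sphere_measure :: 'a::euclidean_space measure)"
  by (rule finite_measureI) (simp add: space_sphere_measure emeasure_sphere_measure_sphere)

lemma measure_sphere_measure_pos: "0 < measure (sphere_measure :: 'a::euclidean_space measure) (sphere 0 1)"
proof -
  have "0 < 2 * pi powr (real DIM('a) / 2) / Gamma (real DIM('a) / 2)"
    by (intro divide_pos_pos Gamma_real_pos) simp_all
  then show ?thesis
    by (simp add: measure_def emeasure_sphere_measure_sphere)
qed

lemma borel_measurable_sphere_measure:
  fixes g :: "'a::euclidean_space \<Rightarrow> real"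
  shows "continuous_on (sphere 0 1) g \<Longrightarrow> g \<in> borel_measurable sphere_measure"
  using borel_measurable_continuous_on_restrict[of "sphere 0 1" g]
  by (simp add: sets_sphere_measure cong: measurable_cong_sets)

lemma integrable_sphere_measure:
  fixes g :: "'a::euclidean_space \<Rightarrow> real"
  assumes g: "continuous_on (sphere 0 1) g"
  shows "integrable sphere_measure g"
proof -
  interpret finite_measure "sphere_measure :: 'a measure" by (rule finite_sphere_measure)
  have "bounded (g ` sphere 0 1)"
    by (intro compact_imp_bounded compact_continuous_image g) simp
  then obtain B where "\<And>x. x \<in> sphere 0 1 \<Longrightarrow> norm (g x) \<le> B"
    unfolding bounded_iff by blast
  then show ?thesis
    by (intro integrable_const_bound[of g B] borel_measurable_sphere_measure g)
       (auto intro!: AE_I2 simp: space_sphere_measure)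
qed

lemma integral_sphere_mono:
  fixes f g :: "'a::euclidean_space \<Rightarrow> real"
  assumes "continuous_on (sphere 0 1) f" "continuous_on (sphere 0 1) g"
    and "\<And>x. norm x = 1 \<Longrightarrow> f x \<le> g x"
  shows "(\<integral>x. f x \<partial>sphere_measure) \<le> (\<integral>x. g x \<partial>sphere_measure)"
  using assms by (intro integral_mono integrable_sphere_measure) (auto simp: space_sphere_measure)

lemma distr_sphere_measure_orthogonal:
  fixes T :: "'a::euclidean_space \<Rightarrow> 'a"
  assumes T: "orthogonal_transformation T"
  shows "T \<in> measurable sphere_measure sphere_measure"
    and "distr sphere_measure sphere_measure T = sphere_measure"
proof -
  have "T \<in> borel \<rightarrow>\<^sub>M borel"
    using orthogonal_transformation_linear[OF T]
    by (intro borel_measurable_continuous_onI linear_continuous_on) (simp add: linear_conv_bounded_linear)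
  then have *: "T \<in> measurable (restrict_space borel (sphere 0 1)) (restrict_space borel (sphere 0 1))"
    by (rule measurable_restrict_space3) (auto simp: orthogonal_transformation_norm[OF T])
  then show meas: "T \<in> measurable sphere_measure sphere_measure"
    by (simp add: sets_sphere_measure cong: measurable_cong_sets)
  show "distr sphere_measure sphere_measure T = sphere_measure"
  proof (rule measure_eqI)
    fix A assume "A \<in> sets (distr sphere_measure sphere_measure T)"
    then have A: "A \<in> sets (sphere_measure :: 'a measure)" by simp
    note A' = sets_sphere_measureD[OF A]
    have V: "T -` A \<inter> sphere 0 1 = T -` A"
      using A'(2) orthogonal_transformation_norm[OF T] by (auto simp: subset_iff)
    have VA: "T -` A \<in> sets borel" "T -` A \<subseteq> sphere 0 1"
      using sets_sphere_measureD[OF measurable_sets[OF meas A]] by (simp_all add: space_sphere_measure V)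
    have C: "{x \<in> ball 0 1 - {0}. x /\<^sub>R norm x \<in> A} \<in> sets borel"
      using measurable_sets[OF radial_projection_measurable, of A] A
      by (simp add: space_restrict_space sets_sphere_measure sets_restrict_space_iff Int_def vimage_def conj_commute)
    have eq: "{x \<in> ball 0 1 - {0}. x /\<^sub>R norm x \<in> T -` A} = T -` {x \<in> ball 0 1 - {0}. x /\<^sub>R norm x \<in> A}"
    proof -
      have "T x = 0 \<longleftrightarrow> x = 0" for x
        using orthogonal_transformation_norm[OF T, of x] by (metis norm_eq_zero)
      then show ?thesis
        by (auto simp: orthogonal_transformation_norm[OF T] orthogonal_transformation_scaleR[OF T])
    qed
    have "emeasure (distr sphere_measure sphere_measure T) A = emeasure sphere_measure (T -` A)"
      by (simp add: emeasure_distr[OF meas A] space_sphere_measure V)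
    also have "\<dots> = emeasure sphere_measure A"
      by (simp only: emeasure_sphere_measure[OF VA] emeasure_sphere_measure[OF A'] eq
          emeasure_lborel_orthogonal_vimage[OF T C])
    finally show "emeasure (distr sphere_measure sphere_measure T) A = emeasure sphere_measure A" .
  qed simp
qed

lemma integral_sphere_orthogonal:
  fixes T :: "'a::euclidean_space \<Rightarrow> 'a" and g :: "'a \<Rightarrow> real"
  assumes T: "orthogonal_transformation T" and g: "continuous_on (sphere 0 1) g"
  shows "(\<integral>x. g (T x) \<partial>sphere_measure) = (\<integral>x. g x \<partial>sphere_measure)"
  using integral_distr[OF distr_sphere_measure_orthogonal(1)[OF T] borel_measurable_sphere_measure[OF g]]
  by (simp add: distr_sphere_measure_orthogonal(2)[OF T])

section \<open>Doubling of spherical caps\<close>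

definition sphere_cap :: "'a::euclidean_space \<Rightarrow> real \<Rightarrow> 'a set" where
  "sphere_cap a \<delta> = {x \<in> sphere 0 1. 1 - a \<bullet> x \<le> \<delta>}"

lemma sets_sphere_cap: "sphere_cap a \<delta> \<in> sets sphere_measure"
proof (rule sets_sphere_measureI)
  have "closed (sphere 0 1 \<inter> {x. 1 - a \<bullet> x \<le> \<delta>})"
    by (intro closed_Int closed_Collect_le continuous_intros closed_sphere)
  moreover have "sphere 0 1 \<inter> {x. 1 - a \<bullet> x \<le> \<delta>} = sphere_cap a \<delta>"
    by (auto simp: sphere_cap_def)
  ultimately show "sphere_cap a \<delta> \<in> sets borel"
    using borel_closed by metis
qed (auto simp: sphere_cap_def)

lemma sphere_cap_mono: "\<delta> \<le> \<epsilon> \<Longrightarrow> sphere_cap a \<delta> \<subseteq> sphere_cap a \<epsilon>"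
  by (auto simp: sphere_cap_def)

text \<open>
  The cone over a spherical cap inside the punctured unit ball, written without division by \<open>norm x\<close>.
\<close>

definition cap_cone :: "'a::euclidean_space \<Rightarrow> real \<Rightarrow> 'a set" where
  "cap_cone a \<delta> = {x \<in> ball 0 1 - {0}. (1 - \<delta>) * norm x \<le> a \<bullet> x}"

lemma emeasure_sphere_cap:
  "emeasure sphere_measure (sphere_cap (a::'a::euclidean_space) \<delta>)
    = ennreal (real DIM('a)) * emeasure lborel (cap_cone a \<delta>)"
proof -
  have "{x \<in> ball 0 1 - {0}. x /\<^sub>R norm x \<in> sphere_cap a \<delta>} = cap_cone a \<delta>"
    by (auto simp: sphere_cap_def cap_cone_def field_simps)
  then show ?thesis
    using emeasure_sphere_measure[OF sets_sphere_measureD[OF sets_sphere_cap[of a \<delta>]]] by simp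
qed

lemma sets_cap_cone: "cap_cone a \<delta> \<in> sets borel"
proof -
  have "closed {x. (1 - \<delta>) * norm x \<le> a \<bullet> x}"
    by (intro closed_Collect_le continuous_intros)
  then have "(ball 0 1 - {0}) \<inter> {x. (1 - \<delta>) * norm x \<le> a \<bullet> x} \<in> sets borel"
    by (intro sets.Int borel_closed borel_open) auto
  then show ?thesis by (simp add: cap_cone_def Int_def)
qed

lemma measure_sphere_cap_pos:
  assumes a: "norm a = 1" and "0 < \<delta>"
  shows "0 < measure sphere_measure (sphere_cap a \<delta>)"
proof -
  interpret finite_measure "sphere_measure :: 'a measure" by (rule finite_sphere_measure)
  have aa: "a \<bullet> a = 1" using a by (simp add: norm_eq_1)
  let ?U = "{x \<in> ball 0 1 - {0}. (1 - \<delta>) * norm x < a \<bullet> x}"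
  have "open ((ball 0 1 - {0}) \<inter> {x. (1 - \<delta>) * norm x < a \<bullet> x})"
    by (intro open_Int open_Collect_less continuous_intros open_Diff) auto
  then have U: "open ?U" by (simp add: Int_def)
  have "a /\<^sub>R 2 \<in> ?U" using a aa \<open>0 < \<delta>\<close> by (auto simp: field_simps)
  then obtain e where e: "e > 0" "ball (a /\<^sub>R 2) e \<subseteq> ?U"
    using U open_contains_ball by blast
  have "0 < emeasure lborel (ball (a /\<^sub>R 2) e)" by (rule emeasure_lborel_ball_pos) fact
  also have "\<dots> \<le> emeasure lborel (cap_cone a \<delta>)"
    using e(2) by (intro emeasure_mono) (auto simp: cap_cone_def sets_cap_cone[unfolded cap_cone_def])
  finally have "0 < emeasure sphere_measure (sphere_cap a \<delta>)"
    by (simp add: emeasure_sphere_cap ennreal_zero_less_mult_iff)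
  then show ?thesis
    by (simp add: emeasure_eq_measure)
qed

text \<open>
  The map \<open>S\<close> fixes \<open>a\<close> and divides the component orthogonal to \<open>a\<close> by 4. For small angles \<open>1 - cos\<close> is
  quadratic in the tangent, so \<open>S\<close> divides the size of a thin cone by about 16. Where
  \<open>a \<bullet> x \<ge> norm x / 2\<close> this approximation costs at most a factor 4, so \<open>S\<close> sends size \<open>2 * \<delta>\<close>
  into size \<open>\<delta> / 2\<close>, in particular into size \<open>\<delta>\<close>.
\<close>

lemma cap_cone_double:
  fixes a :: "'a::euclidean_space"
  assumes a: "norm a = 1" and \<delta>: "0 < \<delta>" "\<delta> \<le> 1 / 4"
  defines "S \<equiv> \<lambda>x. (1/4) *\<^sub>R x + ((3/4) * (a \<bullet> x)) *\<^sub>R a"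
  shows "cap_cone a (2 * \<delta>) \<subseteq> S -` cap_cone a \<delta>"
proof
  fix x assume "x \<in> cap_cone a (2 * \<delta>)"
  then have x: "norm x < 1" "x \<noteq> 0" "(1 - 2 * \<delta>) * norm x \<le> a \<bullet> x" by (auto simp: cap_cone_def)
  have aa: "a \<bullet> a = 1" using a by (simp add: norm_eq_1)
  define n t y s where "n = norm x" and "t = a \<bullet> x" and "y = S x" and "s = norm y"
  have n0: "n > 0" using x by (simp add: n_def)
  have "(1/2) * n \<le> (1 - 2 * \<delta>) * n" using \<delta> n0 by (intro mult_right_mono) auto
  moreover have "(1 - 2 * \<delta>) * n \<le> t" using x(3) by (simp only: n_def t_def)
  ultimately have t: "n / 2 \<le> t" by linarith
  have ty: "a \<bullet> y = t" by (simp add: y_def S_def inner_add_right aa t_def)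
  \<comment> \<open>Decompose along \<open>a\<close>: the axial part \<open>t\<close> is kept and the rest \<open>n\<^sup>2 - t\<^sup>2\<close> is divided by 16.\<close>
  have s2: "s\<^sup>2 = n\<^sup>2 / 16 + 15/16 * t\<^sup>2"
  proof -
    have "s\<^sup>2 = y \<bullet> y" "n\<^sup>2 = x \<bullet> x" by (simp_all add: s_def n_def power2_norm_eq_inner)
    then show ?thesis
      by (simp add: y_def S_def t_def inner_add_left inner_add_right aa inner_commute[of x a]
          power2_eq_square algebra_simps)
  qed
  have tn: "t \<le> n" using norm_cauchy_schwarz[of a x] a by (simp add: n_def t_def)
  have t0: "t > 0" using t n0 by linarith
  have "t\<^sup>2 \<le> n\<^sup>2" using tn t0 by (intro power_mono) auto
  then have sb: "t\<^sup>2 \<le> s\<^sup>2" "s\<^sup>2 \<le> n\<^sup>2" using s2 by auto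
  have s: "t \<le> s" "s \<le> n" using sb t0 n0 by (auto intro: power2_le_imp_le simp: s_def)
  have s0: "s > 0" using s t0 by linarith
  have "16 * ((s - t) * (s + t)) = (n - t) * (n + t)"
    using s2 by (simp add: power2_eq_square algebra_simps)
  also have "\<dots> \<le> (2 * \<delta> * n) * (n + t)"
    using x(3) n0 t0 by (intro mult_right_mono) (auto simp: n_def t_def algebra_simps)
  also have "\<dots> \<le> (2 * \<delta> * (2 * s)) * (2 * (s + t))"
    using \<delta> n0 t t0 s by (intro mult_mono) auto
  finally have "16 * (s - t) * (s + t) \<le> 8 * \<delta> * s * (s + t)" by (simp add: algebra_simps)
  then have "16 * (s - t) \<le> 8 * (\<delta> * s)" using s0 t0 by (simp add: mult_le_cancel_right)
  moreover have "0 \<le> \<delta> * s" using \<delta> s0 by simp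
  ultimately have "s - t \<le> \<delta> * s" unfolding right_diff_distrib by linarith
  then have "(1 - \<delta>) * norm y \<le> a \<bullet> y" by (simp add: ty s_def algebra_simps)
  moreover have "y \<noteq> 0" using s0 by (auto simp: s_def)
  moreover have "norm y < 1" using s x(1) by (simp add: s_def n_def)
  ultimately show "x \<in> S -` cap_cone a \<delta>" by (simp add: cap_cone_def y_def)
qed

text \<open>
  For thin caps the linear map of the previous lemma changes volume by a constant factor only. For
  thick caps it suffices to compare with the whole sphere, since a cap of fixed size has positive
  measure.
\<close>

lemma sphere_cap_doubling:
  fixes a :: "'a::euclidean_space"
  assumes a: "norm a = 1"
  obtains D where "D \<ge> 1"
    "\<And>\<delta>. 0 < \<delta> \<Longrightarrow> measure sphere_measure (sphere_cap a (2 * \<delta>)) \<le> D * measure sphere_measure (sphere_cap a \<delta>)"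
proof -
  interpret finite_measure "sphere_measure :: 'a measure" by (rule finite_sphere_measure)
  have aa: "a \<bullet> a = 1" using a by (simp add: norm_eq_1)
  let ?S = "\<lambda>x. (1/4) *\<^sub>R x + ((3/4) * (a \<bullet> x)) *\<^sub>R a"
  \<comment> \<open>The inverse of \<open>?S\<close>.\<close>
  let ?S' = "\<lambda>x. 4 *\<^sub>R x - (3 * (a \<bullet> x)) *\<^sub>R a"
  have lin: "linear ?S" "linear ?S'"
    by (auto intro!: linearI simp: inner_add_right algebra_simps add_divide_distrib)
  have "?S (?S' x) = x" for x
    by (simp add: inner_diff_right aa algebra_simps)
  then obtain D where D: "D > 0"
    "\<And>A. A \<in> sets borel \<Longrightarrow> emeasure lborel (?S -` A) \<le> ennreal D * emeasure lborel A"
    using emeasure_lborel_linear_vimage_le[OF lin] by blast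
  let ?m = "\<lambda>\<delta>. measure sphere_measure (sphere_cap a \<delta>)"
  have small: "?m (2 * \<delta>) \<le> D * ?m \<delta>" if \<delta>: "0 < \<delta>" "\<delta> \<le> 1/4" for \<delta>
  proof -
    have "?S \<in> borel \<rightarrow>\<^sub>M borel"
      by (intro borel_measurable_continuous_onI continuous_intros)
    then have "?S -` cap_cone a \<delta> \<in> sets borel"
      using measurable_sets[of ?S borel borel, OF _ sets_cap_cone[of a \<delta>]] by simp
    then have "emeasure lborel (cap_cone a (2 * \<delta>)) \<le> emeasure lborel (?S -` cap_cone a \<delta>)"
      by (intro emeasure_mono cap_cone_double a \<delta>) simp
    also have "\<dots> \<le> ennreal D * emeasure lborel (cap_cone a \<delta>)"
      by (rule D(2)[OF sets_cap_cone])
    finally have "emeasure sphere_measure (sphere_cap a (2 * \<delta>)) \<le> ennreal (real DIM('a)) * (ennreal D * emeasure lborel (cap_cone a \<delta>))"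
      unfolding emeasure_sphere_cap by (intro mult_left_mono) auto
    also have "\<dots> = ennreal D * emeasure sphere_measure (sphere_cap a \<delta>)"
      by (simp add: emeasure_sphere_cap mult_ac)
    finally show ?thesis
      using D(1) by (simp add: emeasure_eq_measure ennreal_mult[symmetric])
  qed
  define E where "E = measure (sphere_measure :: 'a measure) (sphere 0 1) / ?m (1/4)"
  have m4: "?m (1/4) > 0" by (rule measure_sphere_cap_pos) (use a in auto)
  have large: "?m (2 * \<delta>) \<le> E * ?m \<delta>" if \<delta>: "\<delta> \<ge> 1/4" for \<delta>
  proof -
    have "?m (2 * \<delta>) \<le> measure (sphere_measure :: 'a measure) (sphere 0 1)"
      using bounded_measure[of "sphere_cap a (2 * \<delta>)"] by (simp add: space_sphere_measure)
    also have "\<dots> = E * ?m (1/4)" using m4 by (simp add: E_def)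
    also have "\<dots> \<le> E * ?m \<delta>"
      using m4 \<delta> by (intro mult_left_mono finite_measure_mono sphere_cap_mono sets_sphere_cap) (auto simp: E_def)
    finally show ?thesis .
  qed
  show thesis
  proof (rule that[of "max 1 (max D E)"])
    fix \<delta> :: real assume "0 < \<delta>"
    then have "?m (2 * \<delta>) \<le> max D E * ?m \<delta>"
      using small[of \<delta>] large[of \<delta>] 
        mult_right_mono[of D "max D E" "?m \<delta>"] mult_right_mono[of E "max D E" "?m \<delta>"]
      by fastforce
    also have "\<dots> \<le> max 1 (max D E) * ?m \<delta>" by (intro mult_right_mono) auto
    finally show "?m (2 * \<delta>) \<le> max 1 (max D E) * ?m \<delta>" .
  qed simp
qed

section \<open>Trigonometric polynomials\<close>

text \<open>
  Generation by exponentials, rather than a coefficient sequence, makes closure under products and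
  properties linear in the function immediate inductions.
\<close>

inductive trig_poly :: "nat \<Rightarrow> (real \<Rightarrow> complex) \<Rightarrow> bool" where
  cis: "\<bar>j\<bar> \<le> int d \<Longrightarrow> trig_poly d (\<lambda>t. c * cis (of_int j * t))"
| add: "trig_poly d f \<Longrightarrow> trig_poly d g \<Longrightarrow> trig_poly d (\<lambda>t. f t + g t)"

lemma trig_poly_mono: "trig_poly d f \<Longrightarrow> d \<le> e \<Longrightarrow> trig_poly e f"
  by (induction rule: trig_poly.induct) (auto intro: trig_poly.intros)

lemma trig_poly_const: "trig_poly d (\<lambda>t. c)"
  using trig_poly.cis[of 0 d c] by (simp add: cis_zero)

lemma trig_poly_mult:
  assumes "trig_poly d f" "trig_poly e g"
  shows "trig_poly (d + e) (\<lambda>t. f t * g t)"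
  using assms(1)
proof induction
  case (cis j d c)
  from assms(2) show ?case
  proof induction
    case (cis k e c')
    have "c * cis (of_int j * t) * (c' * cis (of_int k * t)) = c * c' * cis (of_int (j + k) * t)" for t
    proof -
      have "cis (of_int (j + k) * t) = cis (of_int j * t) * cis (of_int k * t)"
        by (simp add: cis_mult distrib_right)
      then show ?thesis by (simp only: mult_ac)
    qed
    then have "(\<lambda>t. c * cis (of_int j * t) * (c' * cis (of_int k * t))) = (\<lambda>t. c * c' * cis (of_int (j + k) * t))"
      by (rule ext)
    moreover have "\<bar>j + k\<bar> \<le> int (d + e)" using cis \<open>\<bar>j\<bar> \<le> int d\<close> by linarith
    ultimately show ?case using trig_poly.cis[of "j + k" "d + e" "c * c'"] by (simp only:)
  next
    case (add e f g)
    show ?case using trig_poly.add[OF add.IH] by (simp add: distrib_left)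
  qed
next
  case (add d f g)
  show ?case using trig_poly.add[OF add.IH] by (simp add: distrib_right)
qed

lemma trig_poly_power: "trig_poly d f \<Longrightarrow> trig_poly (d * k) (\<lambda>t. f t ^ k)"
proof (induction k)
  case 0
  then show ?case by (simp add: trig_poly_const)
next
  case (Suc k)
  then show ?case using trig_poly_mult[of d f "d * k" "\<lambda>t. f t ^ k"] by simp
qed

lemma trig_poly_prod:
  "finite A \<Longrightarrow> (\<And>i. i \<in> A \<Longrightarrow> trig_poly (d i) (f i)) \<Longrightarrow> trig_poly (\<Sum>i\<in>A. d i) (\<lambda>t. \<Prod>i\<in>A. f i t)"
proof (induction A rule: finite_induct)
  case empty
  then show ?case by (simp add: trig_poly_const)
next
  case (insert i A)
  then show ?case using trig_poly_mult[of "d i" "f i" "\<Sum>i\<in>A. d i"] by simp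
qed

lemma trig_poly_sum: "(\<And>i. i \<in> A \<Longrightarrow> trig_poly d (f i)) \<Longrightarrow> trig_poly d (\<lambda>t. \<Sum>i\<in>A. f i t)"
  by (induction A rule: infinite_finite_induct) (auto intro: trig_poly.add trig_poly_const)

lemma trig_poly_cos_sin:
  "trig_poly 1 (\<lambda>t. complex_of_real (p + q * cos t + r * sin t))"
proof -
  have cs: "complex_of_real (cos t) = (cis t + cis (-t)) / 2"
    "complex_of_real (sin t) = (cis t - cis (-t)) / (2 * \<i>)" for t
    by (auto simp: complex_eq_iff)
  have eq: "(\<lambda>t. complex_of_real (p + q * cos t + r * sin t))
      = (\<lambda>t. (complex_of_real p + (q / 2 + r / (2 * \<i>)) * cis (of_int 1 * t))
             + (q / 2 - r / (2 * \<i>)) * cis (of_int (-1) * t))"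
    by (rule ext) (simp add: cs field_simps)
  show ?thesis
    unfolding eq by (intro trig_poly.add trig_poly_const trig_poly.cis) auto
qed

lemma sum_roots_of_unity_cis:
  assumes "j \<noteq> 0" "\<bar>j\<bar> < int M"
  shows "(\<Sum>k<M. cis (of_int j * (2 * pi * real k / real M))) = 0"
proof -
  define w where "w = cis (of_int j * (2 * pi / real M))"
  have M: "M > 0" using assms by simp
  have "w \<noteq> 1"
  proof
    assume "w = 1"
    then have "cos (of_int j * (2 * pi / real M)) = 1"
      by (simp add: w_def complex_eq_iff)
    then obtain n :: int where "of_int j * (2 * pi / real M) = of_int n * 2 * pi"
      by (auto simp: cos_one_2pi_int)
    then have "real_of_int j = of_int (n * int M)" using M by (simp add: field_simps)
    then have "j = n * int M" by linarith
    then have "int M dvd j" by simp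
    then show False using assms using dvd_imp_le_int[of j "int M"] by simp
  qed
  moreover have "w ^ M = 1"
  proof -
    have "real M * (of_int j * (2 * pi / real M)) = 2 * pi * of_int j" using M by simp
    then show ?thesis
      by (simp only: w_def Complex.DeMoivre) (simp add: complex_eq_iff cos_int_2pin sin_int_2pin)
  qed
  ultimately have "(\<Sum>k<M. w ^ k) = 0"
    by (simp add: sum_gp_strict)
  then show ?thesis
    by (simp add: w_def Complex.DeMoivre mult_ac)
qed

text \<open>
  Equidistant averages over \<open>M\<close> nodes integrate trigonometric polynomials of degree below \<open>M\<close> exactly, and
  therefore do not see where the nodes start. Each nonconstant exponential contributes a multiple of
  a vanishing sum of roots of unity.
\<close>

lemma trig_poly_equidistant_sum:
  assumes "trig_poly d f" "d < M"
  shows "(\<Sum>k<M. f (t + 2 * pi * real k / real M)) = (\<Sum>k<M. f (s + 2 * pi * real k / real M))"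
  using assms
proof (induction rule: trig_poly.induct)
  case (cis j d c)
  have *: "(\<Sum>k<M. c * cis (of_int j * (t + 2 * pi * real k / real M)))
      = c * cis (of_int j * t) * (\<Sum>k<M. cis (of_int j * (2 * pi * real k / real M)))" for t
    by (simp add: sum_distrib_left distrib_left cis_mult[symmetric] mult_ac)
  show ?case
  proof (cases "j = 0")
    case False
    then have "(\<Sum>k<M. cis (of_int j * (2 * pi * real k / real M))) = 0"
      using cis by (intro sum_roots_of_unity_cis) auto
    then show ?thesis unfolding * by simp
  qed simp
qed (simp add: sum.distrib)

section \<open>Rotations in a plane\<close>

text \<open>
  Rotation by the angle \<open>t\<close> in the plane of the orthonormal pair \<open>a, b\<close>, acting as the identity on the orthogonal
  complement.
\<close>

definition plane_rotation :: "'a::real_inner \<Rightarrow> 'a \<Rightarrow> real \<Rightarrow> 'a \<Rightarrow> 'a" where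
  "plane_rotation a b t x = x
     + ((cos t - 1) * (a \<bullet> x) - sin t * (b \<bullet> x)) *\<^sub>R a
     + (sin t * (a \<bullet> x) + (cos t - 1) * (b \<bullet> x)) *\<^sub>R b"

lemma inner_plane_rotation:
  assumes "norm a = 1" "norm b = 1" "a \<bullet> b = 0"
  shows "a \<bullet> plane_rotation a b t x = cos t * (a \<bullet> x) - sin t * (b \<bullet> x)"
  using assms by (simp add: plane_rotation_def inner_add_right norm_eq_1 algebra_simps)

lemma orthogonal_plane_rotation:
  assumes "norm a = 1" "norm b = 1" "a \<bullet> b = 0"
  shows "orthogonal_transformation (plane_rotation a b t)"
  unfolding orthogonal_transformation
proof (intro conjI allI)
  show "linear (plane_rotation a b t)"
    by (rule linearI) (simp_all add: plane_rotation_def inner_add_right algebra_simps)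
  fix x :: 'a
  have 1: "a \<bullet> a = 1" "b \<bullet> b = 1" "b \<bullet> a = 0" using assms by (simp_all add: norm_eq_1 inner_commute)
  define p q where "p = a \<bullet> x" and "q = b \<bullet> x"
  have norm_shift: "(norm (x + \<alpha> *\<^sub>R a + \<beta> *\<^sub>R b))\<^sup>2 = (norm x)\<^sup>2 + (p + \<alpha>)\<^sup>2 - p\<^sup>2 + (q + \<beta>)\<^sup>2 - q\<^sup>2" for \<alpha> \<beta>
    unfolding power2_norm_eq_inner
    by (simp add: inner_add_left inner_add_right 1 assms(3) inner_commute[of x a] inner_commute[of x b] p_def q_def
        power2_eq_square algebra_simps)
  have "(norm (plane_rotation a b t x))\<^sup>2
      = (norm x)\<^sup>2 + (cos t * p - sin t * q)\<^sup>2 - p\<^sup>2 + (sin t * p + cos t * q)\<^sup>2 - q\<^sup>2"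
    unfolding plane_rotation_def norm_shift p_def[symmetric] q_def[symmetric]
    by (simp add: algebra_simps)
  also have "\<dots> = (norm x)\<^sup>2 + ((sin t)\<^sup>2 + (cos t)\<^sup>2 - 1) * (p\<^sup>2 + q\<^sup>2)"
    by (simp only: power2_eq_square) (simp only: algebra_simps)
  finally show "norm (plane_rotation a b t x) = norm x"
    by simp
qed

lemma trig_poly_mpoly_plane_rotation:
  assumes "total_degree p \<le> d"
  shows "trig_poly d (\<lambda>t. complex_of_real (mpoly_eval p (plane_rotation a b t x)))"
proof -
  have coord: "trig_poly 1 (\<lambda>t. complex_of_real (plane_rotation a b t x $ i))" for i
  proof -
    have "plane_rotation a b t x $ i = (x $ i - (a \<bullet> x) * a $ i - (b \<bullet> x) * b $ i)
       + ((a \<bullet> x) * a $ i + (b \<bullet> x) * b $ i) * cos t + ((a \<bullet> x) * b $ i - (b \<bullet> x) * a $ i) * sin t" for t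
      by (simp add: plane_rotation_def algebra_simps)
    then show ?thesis by (simp only: trig_poly_cos_sin)
  qed
  have "trig_poly d (\<lambda>t. complex_of_real (Poly_Mapping.lookup p m) *
          (\<Prod>i\<in>UNIV. complex_of_real (plane_rotation a b t x $ i) ^ Poly_Mapping.lookup m i))"
    if m: "m \<in> Poly_Mapping.keys p" for m
  proof (rule trig_poly_mono)
    show "trig_poly (0 + (\<Sum>i\<in>UNIV. 1 * Poly_Mapping.lookup m i)) (\<lambda>t. complex_of_real (Poly_Mapping.lookup p m) *
          (\<Prod>i\<in>UNIV. complex_of_real (plane_rotation a b t x $ i) ^ Poly_Mapping.lookup m i))"
      by (intro trig_poly_mult trig_poly_const trig_poly_prod trig_poly_power coord) simp
    show "0 + (\<Sum>i\<in>UNIV. 1 * Poly_Mapping.lookup m i) \<le> d"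
      using assms m by (simp add: total_degree_le_iff)
  qed
  then show ?thesis
    unfolding mpoly_eval_def of_real_sum of_real_mult of_real_prod of_real_power by (rule trig_poly_sum)
qed

text \<open>
  The nodes \<open>(2 * k + 1) * pi / M\<close> form the equidistant grid that stays as far as possible from
  the angle 0.
\<close>

lemma cos_odd_node_le:
  assumes "k < M"
  shows "cos (pi * real (2 * k + 1) / real M) \<le> cos (pi / real M)"
proof -
  have M: "0 < real M" using assms by simp
  show ?thesis
  proof (cases "2 * k + 1 \<le> M")
    case True
    have "pi / M \<le> pi * real (2 * k + 1) / M"
      using M by (intro divide_right_mono) auto
    moreover have "pi * real (2 * k + 1) / M \<le> pi"
      using True M by (simp add: divide_le_eq)
    ultimately show ?thesis using M by (intro cos_monotone_0_pi_le) auto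
  next
    case False
    define j where "j = 2 * M - (2 * k + 1)"
    have j: "1 \<le> j" "j \<le> M" "real j = 2 * real M - real (2 * k + 1)" using assms False by (auto simp: j_def)
    have "cos (pi * real (2 * k + 1) / M) = cos (2 * pi - pi * real (2 * k + 1) / M)"
      by simp
    also have "2 * pi - pi * real (2 * k + 1) / M = pi * real j / M"
      using M by (simp add: j(3) field_simps)
    also have "cos (pi * real j / M) \<le> cos (pi / M)"
    proof (rule cos_monotone_0_pi_le)
      show "pi / M \<le> pi * real j / M" using M j(1) by (intro divide_right_mono) auto
      show "pi * real j / M \<le> pi" using M j(2) by (simp add: divide_le_eq)
    qed simp
    finally show ?thesis .
  qed
qed

text \<open>
  On the circle traced by \<open>x\<close> under the rotations, \<open>a \<bullet> y = r * cos (angle)\<close> with \<open>r \<le> 1\<close>. Both summands are trigonometric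
  polynomials of degree below \<open>M\<close> in the angle, so either sum may be computed on the grid that
  avoids the direction of \<open>a\<close>; there every node satisfies \<open>1 - a \<bullet> y \<ge> 1 - cos (pi / M)\<close>. This
  is Fejer's bound on the first Fourier coefficient of a nonnegative trigonometric polynomial,
  proved by quadrature.
\<close>

lemma rotation_sum_lower_bound:
  fixes h :: "'n::finite real_mpoly" and a b x :: "real ^ 'n"
  assumes ab: "norm a = 1" "norm b = 1" "a \<bullet> b = 0" and x: "norm x = 1"
    and h: "total_degree h < M - 1" "\<And>y. mpoly_eval h y \<ge> 0" and M: "2 \<le> M"
  defines "R \<equiv> \<lambda>k::nat. plane_rotation a b (2 * pi * real k / real M)"
  shows "(1 - cos (pi / real M)) * (\<Sum>k<M. mpoly_eval h (R k x))
      \<le> (\<Sum>k<M. mpoly_eval h (R k x) * (1 - a \<bullet> R k x))"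
proof -
  have shift: "(\<Sum>k<M. mpoly_eval p (R k x)) = (\<Sum>k<M. mpoly_eval p (plane_rotation a b (s + 2 * pi * real k / real M) x))"
    if "total_degree p < M" for p :: "'n real_mpoly" and s
  proof -
    have "complex_of_real (\<Sum>k<M. mpoly_eval p (R k x)) =
      (\<Sum>k<M. complex_of_real (mpoly_eval p (plane_rotation a b (0 + 2 * pi * real k / real M) x)))"
      by (simp add: R_def)
    also have "\<dots> = (\<Sum>k<M. complex_of_real (mpoly_eval p (plane_rotation a b (s + 2 * pi * real k / real M) x)))"
      by (rule trig_poly_equidistant_sum[OF trig_poly_mpoly_plane_rotation[OF order_refl] that])
    finally show ?thesis unfolding of_real_sum[symmetric] of_real_eq_iff .
  qed
  define F where "F = h * (mpoly_const 1 + linear_mpoly (- a))"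
  have F: "mpoly_eval F y = mpoly_eval h y * (1 - a \<bullet> y)" for y by (simp add: F_def)
  have degF: "total_degree F < M"
  proof -
    have "total_degree F \<le> (M - 2) + 1"
      unfolding F_def using h(1) total_degree_linear[of "- a"]
      by (intro total_degree_mult total_degree_add) auto
    then show ?thesis using M by linarith
  qed
  \<comment> \<open>Polar coordinates of the projection of \<open>x\<close> to the rotation plane.\<close>
  define z where "z = Complex (a \<bullet> x) (b \<bullet> x)"
  define r \<psi> where "r = norm z" and "\<psi> = Arg z"
  have z: "a \<bullet> x = r * cos \<psi>" "b \<bullet> x = r * sin \<psi>"
  proof -
    have "z = rcis r \<psi>" by (simp add: r_def \<psi>_def rcis_cmod_Arg)
    then show "a \<bullet> x = r * cos \<psi>" "b \<bullet> x = r * sin \<psi>" by (simp_all add: z_def complex_eq_iff)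
  qed
  have r: "0 \<le> r" "r \<le> 1"
  proof -
    \<comment> \<open>Rotating the projection onto the direction of \<open>a\<close> exhibits \<open>r\<close> as an inner product of unit vectors.\<close>
    have "a \<bullet> plane_rotation a b (- \<psi>) x = r * ((cos \<psi>)\<^sup>2 + (sin \<psi>)\<^sup>2)"
      unfolding inner_plane_rotation[OF ab] z power2_eq_square cos_minus sin_minus
      by (simp only: distrib_left) simp
    then have "r = a \<bullet> plane_rotation a b (- \<psi>) x" by simp
    also have "\<dots> \<le> norm a * norm (plane_rotation a b (- \<psi>) x)" by (rule norm_cauchy_schwarz)
    also have "\<dots> = 1" using ab x orthogonal_transformation_norm[OF orthogonal_plane_rotation[OF ab]] by simp
    finally show "r \<le> 1" .
  qed (simp add: r_def)
  \<comment> \<open>The offset that moves the first node to the angle \<open>pi / M\<close> from the direction of \<open>a\<close>.\<close>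
  define s where "s = pi / real M - \<psi>"
  define y where "y k = plane_rotation a b (s + 2 * pi * real k / real M) x" for k :: nat
  have node: "1 - cos (pi / real M) \<le> 1 - a \<bullet> y k" if k: "k < M" for k
  proof -
    have ang: "s + 2 * pi * real k / real M + \<psi> = pi * real (2 * k + 1) / real M"
      using k by (simp add: s_def field_simps)
    have "a \<bullet> y k = r * cos (s + 2 * pi * real k / real M + \<psi>)"
      unfolding y_def inner_plane_rotation[OF ab] z by (subst cos_add) (simp add: algebra_simps)
    then have "a \<bullet> y k = r * cos (pi * real (2 * k + 1) / real M)" by (simp only: ang)
    also have "\<dots> \<le> r * cos (pi / real M)"
      using r by (intro mult_left_mono cos_odd_node_le k)
    also have "\<dots> \<le> 1 * cos (pi / real M)"
    proof (intro mult_right_mono r)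
      have "pi / real M \<le> pi / 2" using M by (intro divide_left_mono) auto
      then show "0 \<le> cos (pi / real M)" by (intro cos_ge_zero) (auto intro: order_trans[of _ 0])
    qed
    finally show ?thesis by simp
  qed
  have "(1 - cos (pi / real M)) * (\<Sum>k<M. mpoly_eval h (R k x))
      = (\<Sum>k<M. mpoly_eval h (y k) * (1 - cos (pi / real M)))"
    using h(1) by (subst shift[of h s]) (auto simp: y_def sum_distrib_left mult.commute)
  also have "\<dots> \<le> (\<Sum>k<M. mpoly_eval F (y k))"
    unfolding F by (intro sum_mono mult_left_mono node h) auto
  also have "\<dots> = (\<Sum>k<M. mpoly_eval F (R k x))"
    unfolding y_def by (rule shift[symmetric, OF degF])
  finally show ?thesis unfolding F .
qed

section \<open>Bounds for sine and cosine\<close>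

lemma sin_ge_half:
  fixes z :: real
  assumes "0 \<le> z" "z \<le> 1"
  shows "z / 2 \<le> sin z"
proof -
  have "\<bar>sin z - z\<bar> \<le> z ^ 3 / 6"
    using Maclaurin_sin_bound[of z 3] assms
    by (simp add: numeral_3_eq_3 sin_coeff_def fact_numeral)
  moreover have "z ^ 3 \<le> z"
    using power_decreasing[of 1 3 z] assms by simp
  ultimately show ?thesis using assms by linarith
qed

lemma one_minus_cos_bounds:
  fixes y :: real
  assumes "0 \<le> y" "y \<le> 2"
  shows "y\<^sup>2 / 8 \<le> 1 - cos y" "1 - cos y \<le> y\<^sup>2 / 2"
proof -
  have eq: "1 - cos y = 2 * (sin (y / 2))\<^sup>2"
    using cos_double_sin[of "y / 2"] by simp
  have "0 \<le> sin (y / 2)" using sin_ge_half[of "y / 2"] assms by auto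
  have "(y / 4)\<^sup>2 \<le> (sin (y / 2))\<^sup>2"
    using sin_ge_half[of "y / 2"] assms by (intro power_mono) auto
  then show "y\<^sup>2 / 8 \<le> 1 - cos y" unfolding eq by (simp add: power_divide)
  have "(sin (y / 2))\<^sup>2 \<le> (y / 2)\<^sup>2"
    using sin_x_le_x[of "y / 2"] assms \<open>0 \<le> sin (y / 2)\<close> by (intro power_mono) auto
  then show "1 - cos y \<le> y\<^sup>2 / 2" unfolding eq by (simp add: power_divide)
qed

section \<open>The Dirichlet kernel as a zonal polynomial\<close>

text \<open>
  The Chebyshev polynomial of the first kind of degree \<open>j\<close>, evaluated at the polynomial \<open>p\<close>.
\<close>

fun chebyshev_at :: "'n::finite real_mpoly \<Rightarrow> nat \<Rightarrow> 'n real_mpoly" where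
  "chebyshev_at p 0 = 1"
| "chebyshev_at p (Suc 0) = p"
| "chebyshev_at p (Suc (Suc j)) = mpoly_const 2 * p * chebyshev_at p (Suc j) + mpoly_const (-1) * chebyshev_at p j"

lemma mpoly_eval_chebyshev:
  "mpoly_eval p x = cos t \<Longrightarrow> mpoly_eval (chebyshev_at p j) x = cos (real j * t)"
proof (induction p j rule: chebyshev_at.induct)
  case (3 p j)
  have "cos (real (Suc (Suc j)) * t) + cos (real j * t) = 2 * cos (real (Suc j) * t) * cos t"
    using cos_plus_cos[of "real (Suc (Suc j)) * t" "real j * t"]
    by (simp add: algebra_simps add_divide_distrib)
  then show ?case using 3 by (simp add: algebra_simps)
qed simp_all

lemma total_degree_chebyshev: "total_degree p \<le> 1 \<Longrightarrow> total_degree (chebyshev_at p j) \<le> j"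
proof (induction p j rule: chebyshev_at.induct)
  case (1 p)
  then show ?case by (simp add: total_degree_def)
next
  case (3 p j)
  have "total_degree (mpoly_const 2 * p) \<le> 0 + 1" 
    by (intro total_degree_mult) (use 3 in auto)
  then have "total_degree (mpoly_const 2 * p * chebyshev_at p (Suc j)) \<le> (0 + 1) + Suc j"
    by (intro total_degree_mult) (use 3 in auto)
  moreover have "total_degree (mpoly_const (-1) * chebyshev_at p j) \<le> 0 + j"
    by (intro total_degree_mult) (use 3 in auto)
  ultimately show ?case unfolding chebyshev_at.simps by (intro total_degree_add) auto
qed simp

text \<open>
  At a point of the sphere at angle \<open>t\<close> from \<open>a\<close> this is the classical kernel
  \<open>sin ((2 * l + 1) * t / 2) / sin (t / 2)\<close>. It has height \<open>2 * l + 1\<close> at \<open>a\<close>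
  and decays like \<open>1 / t\<close>; high even powers of it are Jackson kernels.
\<close>

definition dirichlet_kernel :: "real ^ 'n \<Rightarrow> nat \<Rightarrow> 'n::finite real_mpoly" where
  "dirichlet_kernel a l = mpoly_const 1 + (\<Sum>j\<in>{1..l}. mpoly_const 2 * chebyshev_at (linear_mpoly a) j)"

lemma total_degree_dirichlet_kernel: "total_degree (dirichlet_kernel a l) \<le> l"
  unfolding dirichlet_kernel_def
proof (intro total_degree_add total_degree_sum)
  fix j assume "j \<in> {1..l}"
  then show "total_degree (mpoly_const 2 * chebyshev_at (linear_mpoly a) j) \<le> l"
    using total_degree_mult[of "mpoly_const 2" 0, OF _ total_degree_chebyshev[OF total_degree_linear[of a], of j]]
    by simp
qed simp

lemma mpoly_eval_dirichlet_kernel: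
  assumes "a \<bullet> x = cos t"
  shows "mpoly_eval (dirichlet_kernel a l) x = 1 + 2 * (\<Sum>j\<in>{1..l}. cos (real j * t))"
  using mpoly_eval_chebyshev[of "linear_mpoly a" x t] assms
  by (simp add: dirichlet_kernel_def sum_distrib_left)

lemma dirichlet_kernel_times_sin:
  fixes t :: real
  shows "(1 + 2 * (\<Sum>j\<in>{1..l}. cos (real j * t))) * sin (t / 2) = sin (real (2 * l + 1) * t / 2)"
proof (induction l)
  case (Suc l)
  have "(real (2 * Suc l + 1) * t / 2 - real (2 * l + 1) * t / 2) / 2 = t / 2"
    "(real (2 * Suc l + 1) * t / 2 + real (2 * l + 1) * t / 2) / 2 = real (Suc l) * t"
    by (simp_all add: field_simps)
  then have "sin (real (2 * Suc l + 1) * t / 2) - sin (real (2 * l + 1) * t / 2)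
      = 2 * sin (t / 2) * cos (real (Suc l) * t)"
    using sin_diff_sin[of "real (2 * Suc l + 1) * t / 2" "real (2 * l + 1) * t / 2"] by (simp only:)
  then show ?case using Suc by (simp add: algebra_simps)
qed simp

lemma unit_inner_eq_cos:
  fixes a x :: "'a::real_inner"
  assumes "norm a = 1" "norm x = 1"
  obtains t where "0 \<le> t" "t \<le> pi" "a \<bullet> x = cos t"
proof
  have "\<bar>a \<bullet> x\<bar> \<le> 1" using Cauchy_Schwarz_ineq2[of a x] assms by simp
  then show "0 \<le> arccos (a \<bullet> x)" "arccos (a \<bullet> x) \<le> pi" "a \<bullet> x = cos (arccos (a \<bullet> x))"
    by (auto intro: arccos_lbound arccos_ubound cos_arccos[symmetric] simp: abs_le_iff)
qed

lemma dirichlet_kernel_decay: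
  assumes "norm a = 1" "norm x = 1"
  shows "(mpoly_eval (dirichlet_kernel a l) x)\<^sup>2 * (1 - a \<bullet> x) \<le> 2"
proof -
  obtain t where t: "a \<bullet> x = cos t" using unit_inner_eq_cos[OF assms] by blast
  let ?V = "mpoly_eval (dirichlet_kernel a l) x"
  have "1 - a \<bullet> x = 2 * (sin (t / 2))\<^sup>2"
    using cos_double_sin[of "t / 2"] t by simp
  then have "?V\<^sup>2 * (1 - a \<bullet> x) = 2 * (?V * sin (t / 2))\<^sup>2"
    by (simp add: power_mult_distrib)
  also have "?V * sin (t / 2) = sin (real (2 * l + 1) * t / 2)"
    unfolding mpoly_eval_dirichlet_kernel[OF t] by (rule dirichlet_kernel_times_sin)
  also have "2 * (sin (real (2 * l + 1) * t / 2))\<^sup>2 \<le> 2 * 1"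
    by (intro mult_left_mono) (simp_all add: abs_square_le_1)
  finally show ?thesis by simp
qed

text \<open>
  In the cap of angular radius \<open>1 / m\<close> all angles \<open>j * t\<close> with \<open>j \<le> l\<close> are at most \<open>1 / 2\<close>, so every cosine in the
  kernel is at least \<open>3 / 4\<close>.
\<close>

lemma dirichlet_kernel_peak:
  fixes l :: nat
  defines "m \<equiv> real (2 * l + 1)"
  assumes "norm a = 1" "norm x = 1" and near: "1 - a \<bullet> x \<le> 1 - cos (1 / m)"
  shows "m / 2 \<le> mpoly_eval (dirichlet_kernel a l) x"
proof -
  obtain t where t: "0 \<le> t" "t \<le> pi" "a \<bullet> x = cos t" using unit_inner_eq_cos[OF assms(2,3)] by blast
  have m: "m \<ge> 1" by (simp add: m_def)
  have "1 / m \<le> 1" using m by (simp add: divide_le_eq)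
  then have "1 / m \<le> pi" using pi_ge_two by linarith
  then have tm: "t \<le> 1 / m" using near t m by (subst (asm) t(3)) (simp add: cos_mono_le_eq)
  have "3/4 \<le> cos (real j * t)" if "j \<in> {1..l}" for j
  proof -
    have "real j * t \<le> real l * (1 / m)" using that t tm by (intro mult_mono) auto
    also have "\<dots> \<le> 1 / 2" by (simp add: m_def field_simps)
    finally have jt: "real j * t \<le> 1 / 2" .
    then have "(real j * t)\<^sup>2 \<le> (1/2)\<^sup>2" using t by (intro power_mono) auto
    moreover have "1 - cos (real j * t) \<le> (real j * t)\<^sup>2 / 2"
      using jt t by (intro one_minus_cos_bounds) auto
    ultimately show ?thesis by (simp add: power2_eq_square)
  qed
  then have "(\<Sum>j\<in>{1..l}. 3/4) \<le> (\<Sum>j\<in>{1..l}. cos (real j * t))" by (intro sum_mono) 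
  then show ?thesis unfolding mpoly_eval_dirichlet_kernel[OF t(3)] by (simp add: m_def)
qed

section \<open>Concentration of powers of the Dirichlet kernel\<close>

lemma dyadic_scale:
  fixes u \<delta> :: real
  assumes "\<delta> < u" "u \<le> 2 ^ J * \<delta>"
  shows "\<exists>j<J. 2 ^ j * \<delta> \<le> u \<and> u \<le> 2 ^ Suc j * \<delta>"
  using assms
proof (induction J)
  case (Suc J)
  then show ?case
  proof (cases "u \<le> 2 ^ J * \<delta>")
    case True
    then show ?thesis using Suc less_Suc_eq by metis
  next
    case False
    then show ?thesis using Suc.prems by (intro exI[of _ J]) auto
  qed
qed simp

text \<open>
  Let \<open>\<delta> = 1 - cos (1 / m)\<close>, of order \<open>1 / m\<^sup>2\<close>, and \<open>h\<close> the power of the kernel. Inside the cap of size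
  \<open>\<delta>\<close> the integrand \<open>h x * (1 - a \<bullet> x)\<close> is at most \<open>\<delta> * h x\<close>. Outside, the decay of the kernel bounds it by
  \<open>2 ^ k / (1 - a \<bullet> x) ^ K\<close>; cutting into shells \<open>2 ^ j * \<delta> \<le> 1 - a \<bullet> x \<le> 2 ^ Suc j * \<delta>\<close>, whose measures grow at
  most by the doubling constant \<open>D\<close> per step, the exponent \<open>K\<close> is chosen so that the shells contribute a convergent
  geometric series dominated by the first. Finally the peak of the kernel on the inner cap shows that this
  first shell is at most a constant times \<open>\<delta>\<close> times the integral of \<open>h\<close>.
\<close>

lemma kernel_power_concentrates:
  fixes a :: "real ^ 'n::finite"
  assumes a: "norm a = 1"
  obtains k C where "k > 0" "C > 0"
    "\<And>l. (\<integral>x. mpoly_eval (dirichlet_kernel a l) x ^ (2 * k) * (1 - a \<bullet> x) \<partial>sphere_measure)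
       \<le> C / (real (2 * l + 1))\<^sup>2 * (\<integral>x. mpoly_eval (dirichlet_kernel a l) x ^ (2 * k) \<partial>sphere_measure)"
    "\<And>l. 0 < (\<integral>x. mpoly_eval (dirichlet_kernel a l) x ^ (2 * k) \<partial>sphere_measure)"
proof -
  interpret finite_measure "sphere_measure :: (real ^ 'n) measure" by (rule finite_sphere_measure)
  let ?cap = "sphere_cap a"
  let ?\<sigma> = "\<lambda>\<delta>. measure sphere_measure (?cap \<delta>)"
  obtain D where D: "D \<ge> 1" "\<And>\<delta>. 0 < \<delta> \<Longrightarrow> ?\<sigma> (2 * \<delta>) \<le> D * ?\<sigma> \<delta>"
    using sphere_cap_doubling[OF a] by blast
  have dyadic: "?\<sigma> (2 ^ j * \<delta>) \<le> D ^ j * ?\<sigma> \<delta>" if "0 < \<delta>" for j \<delta>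
  proof (induction j)
    case (Suc j)
    have "?\<sigma> (2 ^ Suc j * \<delta>) \<le> D * ?\<sigma> (2 ^ j * \<delta>)"
      using D(2)[of "2 ^ j * \<delta>"] that by (simp add: mult.assoc)
    also have "\<dots> \<le> D * (D ^ j * ?\<sigma> \<delta>)" using D(1) Suc by (intro mult_left_mono) auto
    finally show ?case by (simp add: mult_ac)
  qed simp
  obtain K where K: "2 * D < 2 ^ K" using real_arch_pow[of 2 "2 * D"] by auto
  \<comment> \<open>One factor of the decay bound is spent on the weight \<open>1 - a \<bullet> x\<close>.\<close>
  define k where "k = Suc K"
  \<comment> \<open>The base 64 collects 2 from the decay of the kernel, 8 from \<open>\<delta> \<ge> 1 / (8 * m\<^sup>2)\<close> and 4 from the height \<open>m / 2\<close> squared.\<close>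
  define C where "C = 1 + 2 * D * 64 ^ k"
  show thesis
  proof (rule that[of k C])
    show "k > 0" by (simp add: k_def)
    show "C > 0" using D(1) by (simp add: C_def add_pos_nonneg)
    fix l
    define m where "m = real (2 * l + 1)"
    define \<delta> where "\<delta> = 1 - cos (1 / m)"
    define h where "h x = mpoly_eval (dirichlet_kernel a l) x ^ (2 * k)" for x
    have m: "m \<ge> 1" by (simp add: m_def)
    have m1: "0 \<le> 1 / m" "1 / m \<le> 2" using m by (auto simp: divide_le_eq)
    have \<delta>: "1 / (8 * m\<^sup>2) \<le> \<delta>" "\<delta> \<le> 1 / (2 * m\<^sup>2)"
      using one_minus_cos_bounds[OF m1] m by (simp_all add: \<delta>_def power_divide)
    have \<delta>0: "0 < \<delta>" using m by (intro less_le_trans[OF _ \<delta>(1)]) simp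
    have h0: "h x \<ge> 0" for x by (simp add: h_def power_mult)
    have cont: "continuous_on (sphere 0 1) h" "continuous_on (sphere 0 1) (\<lambda>x. h x * (1 - a \<bullet> x))"
      unfolding h_def by (intro continuous_intros)+
    note int = cont[THEN integrable_sphere_measure]
    have int_cap: "integrable sphere_measure (indicator (?cap \<epsilon>) :: _ \<Rightarrow> real)" for \<epsilon>
      by (intro integrable_real_indicator sets_sphere_cap) (simp add: emeasure_eq_measure)
    have cap_space: "?cap \<epsilon> \<inter> space sphere_measure = ?cap \<epsilon>" for \<epsilon>
      using sets.sets_into_space[OF sets_sphere_cap[of a \<epsilon>]] by (rule Int_absorb2)
    have capI: "(\<integral>x. indicator (?cap \<epsilon>) x \<partial>sphere_measure) = ?\<sigma> \<epsilon>" for \<epsilon>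
      by (simp add: cap_space)
    let ?I = "\<integral>x. h x \<partial>sphere_measure"
    have lower: "(m / 2) ^ (2 * k) * ?\<sigma> \<delta> \<le> ?I"
    proof -
      have "(\<integral>x. (m / 2) ^ (2 * k) * indicator (?cap \<delta>) x \<partial>sphere_measure) \<le> ?I"
      proof (intro integral_mono integrable_mult_right int_cap int)
        fix x :: "real ^ 'n" assume "x \<in> space sphere_measure"
        then have x: "norm x = 1" by (simp add: space_sphere_measure)
        show "(m / 2) ^ (2 * k) * indicator (?cap \<delta>) x \<le> h x"
        proof (cases "x \<in> ?cap \<delta>")
          case True
          then have "m / 2 \<le> mpoly_eval (dirichlet_kernel a l) x"
            unfolding m_def by (intro dirichlet_kernel_peak a x) (simp add: sphere_cap_def \<delta>_def m_def)
          then have "(m / 2) ^ (2 * k) \<le> h x" unfolding h_def using m by (intro power_mono) auto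
          then show ?thesis using True by simp
        qed (simp add: h0)
      qed
      then show ?thesis by (simp only: integral_mult_right_zero capI)
    qed
    have \<sigma>0: "0 < ?\<sigma> \<delta>" by (rule measure_sphere_cap_pos[OF a \<delta>0])
    then have "0 < (m / 2) ^ (2 * k) * ?\<sigma> \<delta>" using m by simp
    then have I0: "0 < ?I" using lower by linarith
    then show "0 < (\<integral>x. mpoly_eval (dirichlet_kernel a l) x ^ (2 * k) \<partial>sphere_measure)" by (simp add: h_def)
    \<comment> \<open>Enough shells to cover the sphere, on which \<open>1 - a \<bullet> x \<le> 2\<close>.\<close>
    obtain J :: nat where J: "2 / \<delta> < 2 ^ J" using real_arch_pow[of 2 "2 / \<delta>"] by auto
    let ?w = "\<lambda>j. 2 ^ k / (2 ^ j * \<delta>) ^ K"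
    have pointwise: "h x * (1 - a \<bullet> x) \<le> \<delta> * h x + (\<Sum>j<J. ?w j * indicator (?cap (2 ^ Suc j * \<delta>)) x)"
      if x: "norm x = 1" for x
    proof -
      let ?u = "1 - a \<bullet> x"
      have nonneg: "0 \<le> ?w j * indicator (?cap (2 ^ Suc j * \<delta>)) x" for j using \<delta>0 by simp
      show ?thesis
      proof (cases "?u \<le> \<delta>")
        case True
        then have "h x * ?u \<le> h x * \<delta>" by (intro mult_left_mono h0)
        moreover have "0 \<le> (\<Sum>j<J. ?w j * indicator (?cap (2 ^ Suc j * \<delta>)) x)"
          by (intro sum_nonneg nonneg)
        ultimately show ?thesis by (simp add: mult.commute)
      next
        case False
        have u0: "0 < ?u" using False \<delta>0 by linarith
        have "2 \<le> 2 ^ J * \<delta>" using J \<delta>0 by (simp add: divide_less_eq)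
        moreover have "?u \<le> 2" using inner_le_1_of_unit[of "-a" x] a x by simp
        ultimately obtain j where j: "j < J" "2 ^ j * \<delta> \<le> ?u" "?u \<le> 2 ^ Suc j * \<delta>"
          using dyadic_scale[of \<delta> ?u J] False by auto
        have "(h x * ?u) * ?u ^ K = ((mpoly_eval (dirichlet_kernel a l) x)\<^sup>2 * ?u) ^ k"
          unfolding h_def power_mult power_mult_distrib by (simp add: k_def)
        also have "\<dots> \<le> 2 ^ k"
          using u0 by (intro power_mono dirichlet_kernel_decay a x) auto
        finally have "h x * ?u \<le> 2 ^ k / ?u ^ K" using u0 by (simp add: le_divide_eq)
        also have "\<dots> \<le> ?w j"
          using j \<delta>0 u0 by (intro divide_left_mono power_mono mult_pos_pos) auto
        also have "\<dots> = ?w j * indicator (?cap (2 ^ Suc j * \<delta>)) x"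
          using j x by (simp add: sphere_cap_def)
        also have "\<dots> \<le> (\<Sum>j<J. ?w j * indicator (?cap (2 ^ Suc j * \<delta>)) x)"
          using j(1) nonneg by (intro member_le_sum) auto
        also have "\<dots> \<le> \<delta> * h x + \<dots>" using \<delta>0 h0[of x] by simp
        finally show ?thesis .
      qed
    qed
    have "(\<integral>x. h x * (1 - a \<bullet> x) \<partial>sphere_measure)
        \<le> (\<integral>x. \<delta> * h x + (\<Sum>j<J. ?w j * indicator (?cap (2 ^ Suc j * \<delta>)) x) \<partial>sphere_measure)"
      by (intro integral_mono int Bochner_Integration.integrable_add Bochner_Integration.integrable_sum
          integrable_mult_right int_cap pointwise) (simp add: space_sphere_measure)
    also have "\<dots> = \<delta> * ?I + (\<Sum>j<J. ?w j * ?\<sigma> (2 ^ Suc j * \<delta>))"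
      using int(1) int_cap
      by (subst Bochner_Integration.integral_add)
         (auto intro!: Bochner_Integration.integrable_sum simp: Bochner_Integration.integral_sum cap_space simp del: power_Suc)
    also have "(\<Sum>j<J. ?w j * ?\<sigma> (2 ^ Suc j * \<delta>)) \<le> (\<Sum>j<J. 2 ^ k / \<delta> ^ K * D * ?\<sigma> \<delta> * (1/2) ^ j)"
    proof (rule sum_mono)
      fix j
      have "?w j * ?\<sigma> (2 ^ Suc j * \<delta>) \<le> ?w j * (D ^ Suc j * ?\<sigma> \<delta>)"
        using \<delta>0 by (intro mult_left_mono dyadic) auto
      also have "\<dots> = 2 ^ k / \<delta> ^ K * D * ?\<sigma> \<delta> * (D / 2 ^ K) ^ j"
      proof -
        have "(2 ^ j * \<delta>) ^ K = (2 ^ K) ^ j * \<delta> ^ K"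
          by (simp only: power_mult_distrib power_mult[symmetric] mult.commute[of K])
        then show ?thesis by (simp add: power_divide mult_ac)
      qed
      also have "\<dots> \<le> 2 ^ k / \<delta> ^ K * D * ?\<sigma> \<delta> * (1/2) ^ j"
        using \<delta>0 D(1) K by (intro mult_left_mono power_mono) (auto simp: divide_le_eq)
      finally show "?w j * ?\<sigma> (2 ^ Suc j * \<delta>) \<le> 2 ^ k / \<delta> ^ K * D * ?\<sigma> \<delta> * (1/2) ^ j" .
    qed
    also have "\<dots> = 2 ^ k / \<delta> ^ K * D * ?\<sigma> \<delta> * (2 - 2 * (1/2) ^ J)"
      by (simp only: sum_distrib_left[symmetric]) (simp add: sum_gp_strict)
    also have "\<dots> \<le> 2 ^ k / \<delta> ^ K * D * ?\<sigma> \<delta> * 2"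
      using \<delta>0 D(1) by (intro mult_left_mono) auto
    also have "\<dots> \<le> \<delta> * (2 * D * 64 ^ k) * ?I"
    proof -
      have "1 / \<delta> ^ K = \<delta> * (1 / \<delta>) ^ k" using \<delta>0 by (simp add: k_def power_divide)
      also have "\<dots> \<le> \<delta> * (8 * m\<^sup>2) ^ k"
        using \<delta> \<delta>0 m by (intro mult_left_mono power_mono) (auto simp: field_simps)
      \<comment> \<open>The factor \<open>(m / 2) ^ (2 * k)\<close> is what the lower bound on the integral of \<open>h\<close> provides.\<close>
      also have "\<dots> = \<delta> * 32 ^ k * (m / 2) ^ (2 * k)"
      proof -
        have "(8::real) * m\<^sup>2 = 32 * (m / 2)\<^sup>2" by (simp add: power_divide)
        then show ?thesis by (simp only: power_mult_distrib power_mult mult.assoc)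
      qed
      finally have "1 / \<delta> ^ K * (2 ^ k * D * ?\<sigma> \<delta> * 2) \<le> \<delta> * 32 ^ k * (m / 2) ^ (2 * k) * (2 ^ k * D * ?\<sigma> \<delta> * 2)"
        using D(1) by (intro mult_right_mono) auto
      also have "\<dots> = \<delta> * (2 * D * (32 ^ k * 2 ^ k)) * ((m / 2) ^ (2 * k) * ?\<sigma> \<delta>)" by (simp only: mult_ac)
      also have "32 ^ k * 2 ^ k = (64::real) ^ k" by (simp flip: power_mult_distrib)
      also have "\<delta> * (2 * D * 64 ^ k) * ((m / 2) ^ (2 * k) * ?\<sigma> \<delta>) \<le> \<delta> * (2 * D * 64 ^ k) * ?I"
        using \<delta>0 D(1) by (intro mult_left_mono lower) auto
      finally show ?thesis by (simp add: mult_ac)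
    qed
    also have "\<delta> * ?I + \<delta> * (2 * D * 64 ^ k) * ?I = \<delta> * (C * ?I)" by (simp add: C_def algebra_simps)
    also have "\<dots> \<le> 1 / m\<^sup>2 * (C * ?I)"
    proof (intro mult_right_mono)
      show "\<delta> \<le> 1 / m\<^sup>2" using \<delta>(2) m by (simp add: field_simps) 
      show "0 \<le> C * ?I" using I0 \<open>C > 0\<close> by simp
    qed
    finally show "(\<integral>x. mpoly_eval (dirichlet_kernel a l) x ^ (2 * k) * (1 - a \<bullet> x) \<partial>sphere_measure)
       \<le> C / (real (2 * l + 1))\<^sup>2 * (\<integral>x. mpoly_eval (dirichlet_kernel a l) x ^ (2 * k) \<partial>sphere_measure)"
      by (simp add: h_def m_def)
  qed
qed

section \<open>The two rates\<close>

definition feasible :: "nat \<Rightarrow> 'n::finite real_mpoly set" where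
  "feasible r = {h \<in> sos_deg r. (\<integral>x. mpoly_eval h x \<partial>sphere_measure) = 1}"

lemma objective_ge_sphere_min:
  fixes f h :: "'n::finite real_mpoly"
  assumes "h \<in> feasible r"
  shows "sphere_min f \<le> (\<integral>x. mpoly_eval h x * mpoly_eval f x \<partial>sphere_measure)"
proof -
  obtain a where a: "\<And>x. norm x = 1 \<Longrightarrow> sphere_min f \<le> mpoly_eval f x"
    using sphere_min_attained[of f] by metis
  have h: "mpoly_eval h x \<ge> 0" for x
    using assms by (intro mpoly_eval_sos_nonneg) (simp add: feasible_def sos_deg_def)
  have "sphere_min f = (\<integral>x. mpoly_eval h x * sphere_min f \<partial>sphere_measure)"
    using assms by (simp add: feasible_def)
  also have "\<dots> \<le> (\<integral>x. mpoly_eval h x * mpoly_eval f x \<partial>sphere_measure)"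
    by (intro integral_sphere_mono mult_left_mono h a continuous_intros)
  finally show ?thesis .
qed

lemma sos_upper_bound_le:
  assumes "h \<in> feasible r"
  shows "sos_upper_bound f r \<le> (\<integral>x. mpoly_eval h x * mpoly_eval f x \<partial>sphere_measure)"
  unfolding sos_upper_bound_def feasible_def[symmetric]
  by (intro cINF_lower assms bdd_belowI2[of _ "sphere_min f"] objective_ge_sphere_min)

lemma feasible_power2:
  fixes p :: "'n::finite real_mpoly"
  assumes deg: "total_degree p \<le> r" and pos: "0 < (\<integral>x. (mpoly_eval p x)\<^sup>2 \<partial>sphere_measure)"
  obtains h where "h \<in> feasible r"
    "\<And>x. mpoly_eval h x = (mpoly_eval p x)\<^sup>2 / (\<integral>x. (mpoly_eval p x)\<^sup>2 \<partial>sphere_measure)"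
proof -
  let ?I = "\<integral>x. (mpoly_eval p x)\<^sup>2 \<partial>sphere_measure"
  define h where "h = (mpoly_const (1 / sqrt ?I) * p)\<^sup>2"
  have eval: "mpoly_eval h x = (mpoly_eval p x)\<^sup>2 / ?I" for x
    using pos by (simp add: h_def power_mult_distrib power_divide)
  have "total_degree (mpoly_const (1 / sqrt ?I) * p) \<le> 0 + r"
    by (intro total_degree_mult deg) simp
  from total_degree_power[OF this, of 2] have "total_degree h \<le> 2 * r"
    by (simp add: h_def)
  moreover have "(\<integral>x. mpoly_eval h x \<partial>sphere_measure) = 1"
    using pos by (subst eval) simp
  moreover have "h \<in> sos" by (simp add: h_def power2_in_sos)
  ultimately have "h \<in> feasible r" by (simp add: feasible_def sos_deg_def)
  then show thesis using eval by (rule that)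
qed

text \<open>
  The competitor of order \<open>r\<close> is the normalised power \<open>2 * k\<close> of the Dirichlet kernel of degree \<open>r div k\<close> centred at a
  minimiser, with \<open>k\<close> depending only on the minimiser. For \<open>r < k\<close> it is the constant density, and
  \<open>2 * l + 1 \<ge> r / k\<close> still holds.
\<close>

lemma sos_upper_bound_le_quadratic_rate:
  fixes f :: "'n::finite real_mpoly"
  shows "\<exists>C>0. \<forall>r::nat. r \<ge> 1 \<longrightarrow> sos_upper_bound f r - sphere_min f \<le> C / (real r)\<^sup>2"
proof -
  obtain a where a: "norm a = 1" "mpoly_eval f a = sphere_min f"
    "\<And>x. norm x = 1 \<Longrightarrow> sphere_min f \<le> mpoly_eval f x"
    using sphere_min_attained[of f] by metis
  obtain L where L: "L > 0" "\<And>x. norm x = 1 \<Longrightarrow> mpoly_eval f x - mpoly_eval f a \<le> L * (1 - a \<bullet> x)"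
    using quadratic_growth_at_minimiser[of a f] a by metis
  obtain k C where kC: "k > 0" "C > 0"
    "\<And>l. (\<integral>x. mpoly_eval (dirichlet_kernel a l) x ^ (2 * k) * (1 - a \<bullet> x) \<partial>sphere_measure)
       \<le> C / (real (2 * l + 1))\<^sup>2 * (\<integral>x. mpoly_eval (dirichlet_kernel a l) x ^ (2 * k) \<partial>sphere_measure)"
    "\<And>l. 0 < (\<integral>x. mpoly_eval (dirichlet_kernel a l) x ^ (2 * k) \<partial>sphere_measure)"
    using kernel_power_concentrates[OF a(1)] by blast
  have "sos_upper_bound f r - sphere_min f \<le> (L * C * (real k)\<^sup>2) / (real r)\<^sup>2" if r: "r \<ge> 1" for r
  proof -
    define l where "l = r div k"
    define p where "p = dirichlet_kernel a l ^ k"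
    let ?V = "mpoly_eval (dirichlet_kernel a l)"
    let ?I = "\<integral>x. ?V x ^ (2 * k) \<partial>sphere_measure"
    have p2: "(mpoly_eval p x)\<^sup>2 = ?V x ^ (2 * k)" for x
      by (simp add: p_def power_mult[symmetric] mult.commute)
    have "total_degree p \<le> l * k"
      unfolding p_def by (intro total_degree_power total_degree_dirichlet_kernel)
    also have "\<dots> \<le> r" by (simp add: l_def)
    finally obtain h where h: "h \<in> feasible r" "\<And>x. mpoly_eval h x = ?V x ^ (2 * k) / ?I"
      using feasible_power2[of p r] kC(4)[of l] unfolding p2 by metis
    have I0: "?I > 0" by (rule kC(4))
    have norm_h: "(\<integral>x. mpoly_eval h x \<partial>sphere_measure) = 1" using h(1) by (simp add: feasible_def)
    have h0: "mpoly_eval h x \<ge> 0" for x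
      using h(1) by (intro mpoly_eval_sos_nonneg) (simp add: feasible_def sos_deg_def)
    have int_h: "integrable sphere_measure (mpoly_eval h)"
      "integrable sphere_measure (\<lambda>x. mpoly_eval h x * (1 - a \<bullet> x))"
      by (intro integrable_sphere_measure continuous_intros)+
    have "sos_upper_bound f r \<le> (\<integral>x. mpoly_eval h x * mpoly_eval f x \<partial>sphere_measure)"
      by (rule sos_upper_bound_le[OF h(1)])
    also have "\<dots> \<le> (\<integral>x. mpoly_eval h x * sphere_min f + L * (mpoly_eval h x * (1 - a \<bullet> x)) \<partial>sphere_measure)"
    proof (intro integral_sphere_mono continuous_intros)
      fix x :: "real ^ 'n" assume x: "norm x = 1"
      have "mpoly_eval h x * mpoly_eval f x \<le> mpoly_eval h x * (sphere_min f + L * (1 - a \<bullet> x))"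
        using L(2)[OF x] a(2) by (intro mult_left_mono h0) auto
      then show "mpoly_eval h x * mpoly_eval f x \<le> mpoly_eval h x * sphere_min f + L * (mpoly_eval h x * (1 - a \<bullet> x))"
        by (simp add: algebra_simps)
    qed
    also have "\<dots> = sphere_min f + L * (\<integral>x. mpoly_eval h x * (1 - a \<bullet> x) \<partial>sphere_measure)"
      using int_h norm_h by simp
    also have "(\<integral>x. mpoly_eval h x * (1 - a \<bullet> x) \<partial>sphere_measure)
        = (\<integral>x. ?V x ^ (2 * k) * (1 - a \<bullet> x) \<partial>sphere_measure) / ?I"
      by (simp add: h(2))
    also have "\<dots> \<le> C / (real (2 * l + 1))\<^sup>2"
      using kC(3)[of l] I0 by (simp add: divide_le_eq)
    also have "\<dots> \<le> C * (real k)\<^sup>2 / (real r)\<^sup>2"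
    proof -
      have "r < k * (l + 1)"
        using kC(1) by (simp add: l_def) (metis add.commute dividend_less_div_times mult.commute)
      also have "\<dots> \<le> k * (2 * l + 1)" by (intro mult_left_mono) auto
      finally have "real r \<le> real (k * (2 * l + 1))" by (simp only: of_nat_le_iff less_imp_le)
      then have "real r \<le> real k * real (2 * l + 1)" by (simp only: of_nat_mult)
      then have "(real r)\<^sup>2 \<le> (real k * real (2 * l + 1))\<^sup>2" by (intro power_mono) auto
      then have "C * (real r)\<^sup>2 \<le> C * (real k)\<^sup>2 * (real (2 * l + 1))\<^sup>2"
        using kC(2) by (simp add: power_mult_distrib mult.assoc)
      then show ?thesis using r by (simp add: frac_le_eq divide_le_eq le_divide_eq mult_ac)
    qed
    finally show ?thesis using L(1) by (simp add: mult_left_mono mult.assoc)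
  qed
  then show ?thesis using L(1) kC(1,2) by (intro exI[of _ "L * C * (real k)\<^sup>2"]) auto
qed

lemma exists_orthogonal_unit_vector:
  fixes a :: "real ^ 'n::finite"
  assumes "CARD('n) \<ge> 2"
  obtains b where "norm b = 1" "a \<bullet> b = 0"
proof -
  have "2 \<le> DIM(real ^ 'n)" using assms by simp
  then obtain y where y: "y \<noteq> 0" "orthogonal a y"
    using orthogonal_to_vector_exists[of a] by blast
  then show thesis
    by (intro that[of "y /\<^sub>R norm y"]) (auto simp: orthogonal_def)
qed

text \<open>
  Surface measure is invariant under the rotations in a plane containing \<open>a\<close>, so both integrals may be replaced
  by integrals of averages over \<open>M\<close> equidistant rotations, which compare pointwise. Since \<open>h\<close> has degree at most
  \<open>2 * r\<close>, the weighted density has degree at most \<open>2 * r + 1\<close>, whence \<open>M = 2 * r + 2\<close>.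
  A second direction, hence dimension at least 2, is needed to rotate.
\<close>

lemma no_concentration:
  fixes h :: "'n::finite real_mpoly" and a :: "real ^ 'n"
  assumes card: "CARD('n) \<ge> 2" and a: "norm a = 1" and h: "h \<in> sos_deg r"
  shows "(1 - cos (pi / real (2 * r + 2))) * (\<integral>x. mpoly_eval h x \<partial>sphere_measure)
      \<le> (\<integral>x. mpoly_eval h x * (1 - a \<bullet> x) \<partial>sphere_measure)"
proof -
  define M where "M = 2 * r + 2"
  obtain b where b: "norm b = 1" "a \<bullet> b = 0" using exists_orthogonal_unit_vector[OF card] by metis
  define R where "R k = plane_rotation a b (2 * pi * real k / real M)" for k :: nat
  have R: "orthogonal_transformation (R k)" for k
    unfolding R_def by (rule orthogonal_plane_rotation[OF a b])
  have contR: "continuous_on A (R k)" for A k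
    by (intro linear_continuous_on) (simp add: R orthogonal_transformation_linear linear_conv_bounded_linear[symmetric])
  let ?h = "mpoly_eval h" and ?F = "\<lambda>x. mpoly_eval h x * (1 - a \<bullet> x)"
  have cont: "continuous_on A ?h" "continuous_on A ?F" for A by (intro continuous_intros)+
  have contRk: "continuous_on A (\<lambda>x. ?h (R k x))" "continuous_on A (\<lambda>x. ?F (R k x))" for A k
    by (intro continuous_intros contR)+
  have avg: "(\<integral>x. (\<Sum>k<M. g (R k x)) \<partial>sphere_measure) = real M * (\<integral>x. g x \<partial>sphere_measure)"
    if "\<And>A. continuous_on A g" "\<And>k A. continuous_on A (\<lambda>x. g (R k x))" for g :: "real ^ 'n \<Rightarrow> real"
    using that by (simp add: Bochner_Integration.integral_sum integrable_sphere_measure integral_sphere_orthogonal[OF R])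
  have "real M * ((1 - cos (pi / real M)) * (\<integral>x. ?h x \<partial>sphere_measure))
      = (\<integral>x. (1 - cos (pi / real M)) * (\<Sum>k<M. ?h (R k x)) \<partial>sphere_measure)"
    using avg[of ?h, OF cont(1) contRk(1)] by simp
  also have "\<dots> \<le> (\<integral>x. (\<Sum>k<M. ?F (R k x)) \<partial>sphere_measure)"
  proof (rule integral_sphere_mono)
    fix x :: "real ^ 'n" assume x: "norm x = 1"
    show "(1 - cos (pi / real M)) * (\<Sum>k<M. ?h (R k x)) \<le> (\<Sum>k<M. ?F (R k x))"
      unfolding R_def using h
      by (intro rotation_sum_lower_bound a b x mpoly_eval_sos_nonneg) (auto simp: M_def sos_deg_def)
  qed (intro continuous_intros contRk contR)+
  also have "\<dots> = real M * (\<integral>x. ?F x \<partial>sphere_measure)"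
    by (rule avg[of ?F, OF cont(2) contRk(2)])
  finally show ?thesis by (simp add: M_def)
qed

text \<open>
  For \<open>f x = c \<bullet> x\<close> with minimiser \<open>a = - c / norm c\<close>, the excess \<open>f x - f a\<close> equals \<open>norm c * (1 - a \<bullet> x)\<close>
  exactly on the sphere, so the bound on concentration of densities near \<open>a\<close> applies directly.
\<close>

lemma sos_upper_bound_ge_quadratic_rate:
  fixes f :: "'n::finite real_mpoly"
  assumes card: "CARD('n) \<ge> 2" and f: "nonzero_linear f"
  shows "\<exists>c>0. \<forall>r::nat. r \<ge> 1 \<longrightarrow> sos_upper_bound f r - sphere_min f \<ge> c / (real r)\<^sup>2"
proof -
  obtain c where c: "c \<noteq> 0" "f = linear_mpoly c"
    using f by (auto simp: nonzero_linear_def linear_mpoly_def)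
  define a where "a = - (c /\<^sub>R norm c)"
  have a: "norm a = 1" using c by (simp add: a_def)
  have f_eq: "mpoly_eval f x = - norm c * (a \<bullet> x)" for x using c by (simp add: a_def)
  have min: "sphere_min f = - norm c"
  proof -
    obtain b where b: "norm b = 1" "mpoly_eval f b = sphere_min f" "\<And>x. norm x = 1 \<Longrightarrow> sphere_min f \<le> mpoly_eval f x"
      using sphere_min_attained[of f] by metis
    have "sphere_min f \<le> - norm c" using b(3)[OF a] a by (simp add: f_eq norm_eq_1)
    moreover have "- norm c * 1 \<le> - norm c * (a \<bullet> b)"
      using inner_le_1_of_unit[OF a b(1)] by (intro mult_left_mono_neg) auto
    ultimately show ?thesis using b(2) by (simp add: f_eq)
  qed
  have "norm c / 32 / (real r)\<^sup>2 \<le> sos_upper_bound f r - sphere_min f" if r: "r \<ge> 1" for r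
  proof -
    have nonempty: "feasible r \<noteq> ({} :: 'n real_mpoly set)"
    proof -
      have "total_degree (1 :: 'n real_mpoly) \<le> r" by (simp add: total_degree_def)
      moreover have "0 < (\<integral>x. (mpoly_eval 1 (x :: real ^ 'n))\<^sup>2 \<partial>sphere_measure)"
        using measure_sphere_measure_pos by (simp add: space_sphere_measure)
      ultimately show ?thesis using feasible_power2[of "1 :: 'n real_mpoly" r] by blast
    qed
    have "sphere_min f + norm c / 32 / (real r)\<^sup>2 \<le> (\<integral>x. mpoly_eval h x * mpoly_eval f x \<partial>sphere_measure)"
      if h: "h \<in> feasible r" for h
    proof -
      define y where "y = pi / real (2 * r + 2)"
      have y: "1 / (2 * real r + 2) * 2 \<le> y" "0 \<le> y" "y \<le> 2"
      proof -
        show "1 / (2 * real r + 2) * 2 \<le> y" using pi_ge_two by (simp add: y_def divide_right_mono add.commute)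
        have "y \<le> pi / 2" unfolding y_def by (intro divide_left_mono) auto
        then show "y \<le> 2" using pi_less_4 by linarith
      qed (simp add: y_def)
      have hs: "h \<in> sos_deg r" "(\<integral>x. mpoly_eval h x \<partial>sphere_measure) = 1"
        using h by (simp_all add: feasible_def)
      have "1 / (2 * real r) \<le> 1 / (real r + 1)" using r by (intro divide_left_mono) auto
      also have "\<dots> \<le> y" using y(1) by (simp add: field_simps)
      finally have "(1 / (2 * real r))\<^sup>2 \<le> y\<^sup>2" by (intro power_mono) auto
      then have "1 / (32 * (real r)\<^sup>2) \<le> y\<^sup>2 / 8" by (simp add: power_divide power_mult_distrib)
      also have "\<dots> \<le> 1 - cos y" by (rule one_minus_cos_bounds(1)[OF y(2,3)])
      also have "\<dots> \<le> (\<integral>x. mpoly_eval h x * (1 - a \<bullet> x) \<partial>sphere_measure)"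
        using no_concentration[OF card a hs(1)] hs(2) by (simp add: y_def)
      finally have "1 / (32 * (real r)\<^sup>2) \<le> (\<integral>x. mpoly_eval h x * (1 - a \<bullet> x) \<partial>sphere_measure)" .
      then have "norm c * (1 / (32 * (real r)\<^sup>2)) \<le> norm c * (\<integral>x. mpoly_eval h x * (1 - a \<bullet> x) \<partial>sphere_measure)"
        by (intro mult_left_mono) auto
      also have "\<dots> = (\<integral>x. norm c * (mpoly_eval h x * (1 - a \<bullet> x)) \<partial>sphere_measure)" by simp
      also have "\<dots> = (\<integral>x. mpoly_eval h x * mpoly_eval f x - mpoly_eval h x * sphere_min f \<partial>sphere_measure)"
        by (rule Bochner_Integration.integral_cong) (simp_all add: f_eq min algebra_simps)
      also have "\<dots> = (\<integral>x. mpoly_eval h x * mpoly_eval f x \<partial>sphere_measure) - sphere_min f"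
        using hs(2)
        by (subst Bochner_Integration.integral_diff) (auto intro!: integrable_sphere_measure continuous_intros)
      finally show ?thesis by simp
    qed
    then show ?thesis
      unfolding sos_upper_bound_def feasible_def[symmetric]
      using cINF_greatest[OF nonempty, of "sphere_min f + norm c / 32 / (real r)\<^sup>2"]
      by (simp add: le_diff_eq add.commute)
  qed
  then show ?thesis using c(1) by (intro exI[of _ "norm c / 32"]) auto
qed

theorem theorem1:
  assumes "CARD('n::finite) \<ge> 2"
  shows "(\<forall>f :: 'n real_mpoly. \<exists>C>0. \<forall>r::nat. r \<ge> 1 \<longrightarrow>
            sos_upper_bound f r - sphere_min f \<le> C / (real r)\<^sup>2)
       \<and> (\<forall>f :: 'n real_mpoly. nonzero_linear f \<longrightarrow>
            (\<exists>c>0. \<forall>r::nat. r \<ge> 1 \<longrightarrow>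
              sos_upper_bound f r - sphere_min f \<ge> c / (real r)\<^sup>2))"
  using sos_upper_bound_le_quadratic_rate sos_upper_bound_ge_quadratic_rate[OF assms] by blast

end
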